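(* Let $A$ be a finite non-local commutative ring. Then the line graph $L(\Gamma(A))$ of the zero-divisor graph of $A$ is outerplanar if and only if $A$ is isomorphic to one of the rings: $\mathbb{Z}_2\times\mathbb{Z}_2$, $\mathbb{Z}_2\times\mathbb{Z}_3$, $\mathbb{Z}_3\times\mathbb{Z}_3$, $\mathbb{Z}_2\times\mathbb{F}_4$, $\mathbb{Z}_2\times\mathbb{Z}_4$, $\mathbb{Z}_2\times\frac{\mathbb{Z}_2[x]}{\langle x^2\rangle}$, $\mathbb{Z}_2\times\mathbb{Z}_2\times\mathbb{Z}_2$.
   Context: All rings have unity $1\neq 0$. $\mathbb{Z}_n$ is the ring of integers modulo $n$ and $\mathbb{F}_n$ the finite field with $n$ elements. A ring is local if it has exactly one maximal ideal. The zero-divisor graph $\Gamma(A)$ of a commutative ring $A$ is the simple undirected graph whose vertices are the non-zero zero-divisors of $A$, two distinct vertices $u,v$ being adjacent if and only if $uv=0$. The line graph $L(G)$ of a graph $G$ has the edges of $G$ as vertices, two distinct ones being adjacent exactly when the corresponding edges share an endpoint in $G$. A graph is outerplanar if it can be drawn in the plane without edge crossings and with all vertices on the boundary of the unbounded region. *)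

theory Defs
  imports
    "HOL-Analysis.Analysis"
    "HOL-Algebra.Algebra"
    "HOL-Number_Theory.Residues"
begin

section \<open>Simple graphs and line graphs\<close>

text \<open>An edge is the two-element set of its endpoints.\<close>

record 'v sgraph =
  vertices :: "'v set"
  edges :: "'v set set"

definition line_graph :: "'v sgraph \<Rightarrow> 'v set sgraph" where
  "line_graph G =
     \<lparr> vertices = edges G,
       edges = {{e, f} | e f. e \<in> edges G \<and> f \<in> edges G \<and> e \<noteq> f \<and> e \<inter> f \<noteq> {}} \<rparr>"


section \<open>Outerplanar graphs\<close>

text \<open>
  The plane is \<^typ>\<open>complex\<close>. In a drawing \<open>(p, \<gamma>)\<close>, the vertex \<open>v\<close> is the point \<open>p v\<close> and the
  edge \<open>e\<close> is the simple arc \<open>\<gamma> e\<close>, traversed in either direction. An arc passes through no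
  vertex other than its endpoints, and two arcs meet at most in the image of a common endpoint.
\<close>

definition plane_drawing ::
    "'v sgraph \<Rightarrow> ('v \<Rightarrow> complex) \<Rightarrow> ('v set \<Rightarrow> real \<Rightarrow> complex) \<Rightarrow> bool" where
  "plane_drawing G p \<gamma> \<longleftrightarrow>
     inj_on p (vertices G) \<and>
     (\<forall>e\<in>edges G. arc (\<gamma> e) \<and> {pathstart (\<gamma> e), pathfinish (\<gamma> e)} = p ` e) \<and>
     (\<forall>e\<in>edges G. path_image (\<gamma> e) \<inter> p ` vertices G = p ` e) \<and>
     (\<forall>e\<in>edges G. \<forall>f\<in>edges G. e \<noteq> f \<longrightarrow>
        path_image (\<gamma> e) \<inter> path_image (\<gamma> f) = p ` (e \<inter> f))"

definition drawing_points ::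
    "'v sgraph \<Rightarrow> ('v \<Rightarrow> complex) \<Rightarrow> ('v set \<Rightarrow> real \<Rightarrow> complex) \<Rightarrow> complex set" where
  "drawing_points G p \<gamma> = p ` vertices G \<union> (\<Union>e\<in>edges G. path_image (\<gamma> e))"

text \<open>
  For a finite graph the set of drawing points is compact, so its complement has exactly one
  unbounded component, and this component is its \<^const>\<open>outside\<close>.
\<close>

definition outerplanar :: "'v sgraph \<Rightarrow> bool" where
  "outerplanar G \<longleftrightarrow>
     (\<exists>p \<gamma>. plane_drawing G p \<gamma> \<and>
            p ` vertices G \<subseteq> frontier (outside (drawing_points G p \<gamma>)))"


section \<open>Rings and zero-divisor graphs\<close>

definition local_ring :: "('a, 'm) ring_scheme \<Rightarrow> bool" where
  "local_ring R \<longleftrightarrow> (\<exists>!I. maximalideal I R)"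

definition nonzero_zero_divisors :: "('a, 'm) ring_scheme \<Rightarrow> 'a set" where
  "nonzero_zero_divisors R =
     {u \<in> carrier R - {\<zero>\<^bsub>R\<^esub>}. \<exists>v \<in> carrier R - {\<zero>\<^bsub>R\<^esub>}. u \<otimes>\<^bsub>R\<^esub> v = \<zero>\<^bsub>R\<^esub>}"

definition zero_divisor_graph :: "('a, 'm) ring_scheme \<Rightarrow> 'a sgraph" where
  "zero_divisor_graph R =
     \<lparr> vertices = nonzero_zero_divisors R,
       edges = {{u, v} | u v. u \<in> nonzero_zero_divisors R \<and> v \<in> nonzero_zero_divisors R \<and>
                              u \<noteq> v \<and> u \<otimes>\<^bsub>R\<^esub> v = \<zero>\<^bsub>R\<^esub>} \<rparr>"

abbreviation Z2_dual_numbers :: "int list set ring" where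
  "Z2_dual_numbers \<equiv>
     poly_ring (residue_ring 2) Quot
       (Idl\<^bsub>poly_ring (residue_ring 2)\<^esub>
          {X\<^bsub>residue_ring 2\<^esub> [^]\<^bsub>poly_ring (residue_ring 2)\<^esub> (2::nat)})"

end

theory Submission
  imports Defs
begin

text \<open>
  A finite non-local ring \<open>A\<close> has an idempotent \<open>e\<close> other than \<open>0\<close> and \<open>1\<close> and is therefore a product
  of two nonzero rings, the corners \<open>eA\<close> and \<open>(1 - e)A\<close>. In the zero-divisor graph each nonzero element
  of one corner is adjacent to each nonzero element of the other. Hence a corner with more than four
  elements produces a vertex with four neighbours, whose edges are four pairwise adjacent vertices of
  the line graph; and corners with at least three and at least four elements produce a complete
  bipartite graph on two and three vertices, whose line graph is a prism. Neither the complete graph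
  on four vertices nor the prism is outerplanar, and this leaves for the corners only the orders two
  and at most four, or three and three. The rings of these orders are easily
  listed (\<open>card4_classification\<close>), which gives the list of the theorem.

  The topological core is the lemma \<open>K4_drawing_vertex_inside\<close>: in a plane drawing of a subdivision
  of the complete graph on four vertices, one branch vertex is inside the cycle through the other three,
  and such a vertex is not on the boundary of the unbounded region. The prism contains
  such a subdivision. The proof rests on the fact that of three arcs with common ends one is
  enclosed by the other two (\<open>theta_arc_inside\<close>), a consequence of Janiszewski's theorem.

  Conversely, apart from \<open>\<int>\<^sub>3 \<times> \<int>\<^sub>3\<close>, whose zero-divisor graph is a four-cycle, the
  zero-divisor graph of each listed ring embeds into the net, a triangle with a pendant vertex at each
  corner. Both line graphs are subgraphs of a hexagon with an inscribed triangle, which is drawn with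
  non-crossing chords of a parabola.
\<close>

section \<open>Arcs in the plane and theta graphs\<close>

text \<open>
  Only the point set and the two ends of an arc are recorded, so that the arbitrary orientation of a
  drawn edge disappears and arcs can be joined and reversed without mentioning paths.
\<close>

definition arc_between :: "complex set \<Rightarrow> complex \<Rightarrow> complex \<Rightarrow> bool" where
  "arc_between S a b \<longleftrightarrow>
     (\<exists>g. arc g \<and> path_image g = S \<and> pathstart g = a \<and> pathfinish g = b)"

lemma arc_between_sym: "arc_between S a b \<Longrightarrow> arc_between S b a"
  unfolding arc_between_def
  by (metis arc_reversepath path_image_reversepath pathfinish_reversepath pathstart_reversepath)

lemma arc_between_join:
  assumes "arc_between S a b" "arc_between T b c" "S \<inter> T = {b}"
  shows "arc_between (S \<union> T) a c"
proof -
  obtain g h where "arc g" "path_image g = S" "pathstart g = a" "pathfinish g = b"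
    "arc h" "path_image h = T" "pathstart h = b" "pathfinish h = c"
    using assms unfolding arc_between_def by auto
  then show ?thesis
    unfolding arc_between_def using assms(3)
    by (intro exI[of _ "g +++ h"]) (auto simp: path_image_join intro!: arc_join)
qed

lemma arc_betweenD:
  assumes "arc_between S a b"
  shows "compact S" "connected S" "connected (S - {a, b})" "a \<in> S" "b \<in> S" "a \<noteq> b"
proof -
  obtain g where g: "arc g" "path_image g = S" "pathstart g = a" "pathfinish g = b"
    using assms unfolding arc_between_def by auto
  show "compact S" "connected S"
    using g compact_arc_image connected_arc_image by metis+
  show "connected (S - {a, b})"
    using g connected_simple_path_endless[OF arc_imp_simple_path[OF g(1)]] by simp
  show "a \<in> S" "b \<in> S"
    using g by auto
  show "a \<noteq> b"
    using arc_distinct_ends[OF g(1)] g(3,4) by simp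
qed

text \<open>
  A connected set with more than one point has no isolated points, and deleting two points does not
  change limit points. This is how the position of an open arc determines the position of its ends.
\<close>

lemma arc_between_endpoint_limit:
  assumes "arc_between S a b"
  shows "b \<in> closure (S - {a, b})"
proof -
  note S = arc_betweenD[OF assms]
  have "S \<noteq> {x}" for x
    using S(4-6) by auto
  then have "b islimpt S"
    using connected_imp_perfect[OF S(2,5)] by blast
  moreover have "{a, b} \<union> (S - {a, b}) = S"
    using S(4,5) by auto
  ultimately have "b islimpt ({a, b} \<union> (S - {a, b}))"
    by simp
  then have "b islimpt (S - {a, b})"
    by (subst (asm) islimpt_Un_finite) simp_all
  then show ?thesis
    by (simp add: closure_def)
qed

lemma arc_between_interior_nonempty: "arc_between S a b \<Longrightarrow> S - {a, b} \<noteq> {}"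
  by (metis arc_between_endpoint_limit closure_empty empty_iff)

lemma Jordan_two_arcs:
  assumes "arc_between S a b" "arc_between T a b" "S \<inter> T = {a, b}"
  shows "connected (inside (S \<union> T))" "connected (outside (S \<union> T))"
    "frontier (inside (S \<union> T)) = S \<union> T" "inside (S \<union> T) \<noteq> {}"
    "open (inside (S \<union> T))"
proof -
  obtain g h where gh: "arc g" "path_image g = S" "pathstart g = a" "pathfinish g = b"
    "arc h" "path_image h = T" "pathstart h = b" "pathfinish h = a"
    using assms(1) arc_between_sym[OF assms(2)] unfolding arc_between_def by auto
  have simple: "simple_path (g +++ h)"
    by (rule simple_path_join_loop) (use gh assms(3) in simp_all)
  have loop: "pathfinish (g +++ h) = pathstart (g +++ h)" "path_image (g +++ h) = S \<union> T"
    using gh by (simp_all add: path_image_join)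
  note Jordan = Jordan_inside_outside[OF simple loop(1), unfolded loop(2)]
  show "connected (inside (S \<union> T))" "connected (outside (S \<union> T))"
    "frontier (inside (S \<union> T)) = S \<union> T" "inside (S \<union> T) \<noteq> {}"
    "open (inside (S \<union> T))"
    using Jordan by meson+
qed

text \<open>
  The inside and the outside of a closed set are open and disjoint and cover its complement.
\<close>

lemma connected_inside_or_outside:
  fixes C :: "complex set"
  assumes "connected V" "V \<inter> C = {}" "closed C"
  shows "V \<subseteq> inside C \<or> V \<subseteq> outside C"
proof -
  have cover: "V \<subseteq> inside C \<union> outside C"
    using assms(2) by auto
  have "inside C \<inter> V = {} \<or> outside C \<inter> V = {}"
    by (rule connectedD[OF assms(1) open_inside open_outside]) (use assms(3) cover in simp_all)
  then show ?thesis
    using cover by blast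
qed

lemma connected_component_Compl_outside:
  assumes "connected (outside C)" "x \<in> outside C" "y \<in> outside C"
  shows "connected_component (- C) x y"
proof -
  have "outside C \<subseteq> - C"
    using outside_no_overlap by blast
  then show ?thesis
    unfolding connected_component_def using assms by blast
qed

text \<open>
  In a theta graph, three arcs with common ends \<open>a\<close> and \<open>b\<close>, one of the arcs runs inside the closed
  curve formed by the other two. Otherwise each open arc lies outside the curve formed by the other
  two. Then the inside \<open>I\<close> of \<open>T \<union> U\<close> avoids the whole theta graph, and as its boundary contains
  points of \<open>U\<close> and of \<open>T\<close>, it is contained in the outside of \<open>S \<union> T\<close> and in that of \<open>S \<union> U\<close>.
  So a point of \<open>I\<close> can be joined to a point \<open>w\<close> far away both in the complement of \<open>S \<union> T\<close> and in the
  complement of \<open>S \<union> U\<close>. The two curves meet in the connected set \<open>S\<close>, so by Janiszewski's theorem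
  the points can be joined in the complement of the theta graph, so that \<open>I\<close> lies outside \<open>T \<union> U\<close>,
  which is absurd.
\<close>

lemma theta_arc_inside:
  assumes S: "arc_between S a b" and T: "arc_between T a b" and U: "arc_between U a b"
    and ST: "S \<inter> T = {a, b}" and SU: "S \<inter> U = {a, b}" and TU: "T \<inter> U = {a, b}"
  shows "S - {a, b} \<subseteq> inside (T \<union> U) \<or> T - {a, b} \<subseteq> inside (S \<union> U) \<or>
    U - {a, b} \<subseteq> inside (S \<union> T)"
proof (rule ccontr)
  assume not_inside: "\<not> ?thesis"
  have closed: "closed S" "closed T" "closed U"
    using S T U arc_betweenD(1) compact_imp_closed by metis+
  have out: "V - {a, b} \<subseteq> outside (P \<union> Q)"
    if V: "arc_between V a b" "V \<inter> P = {a, b}" "V \<inter> Q = {a, b}" "closed P" "closed Q"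
      "\<not> V - {a, b} \<subseteq> inside (P \<union> Q)" for V P Q
  proof -
    have "(V - {a, b}) \<inter> (P \<union> Q) = {}"
      using V(2,3) by auto
    then show ?thesis
      using connected_inside_or_outside[OF arc_betweenD(3)[OF V(1)]] V(4-6) closed_Un by metis
  qed
  have S_out: "S - {a, b} \<subseteq> outside (T \<union> U)"
    by (rule out) (use S ST SU closed not_inside in simp_all)
  have T_out: "T - {a, b} \<subseteq> outside (S \<union> U)"
    by (rule out) (use T ST TU closed not_inside in \<open>simp_all add: Int_commute\<close>)
  have U_out: "U - {a, b} \<subseteq> outside (S \<union> T)"
    by (rule out) (use U SU TU closed not_inside in \<open>simp_all add: Int_commute\<close>)
  define I where "I = inside (T \<union> U)"
  note J = Jordan_two_arcs[OF T U TU, folded I_def]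
  have I_disj: "I \<inter> (S \<union> T \<union> U) = {}"
  proof -
    have "I \<inter> (T \<union> U) = {}"
      unfolding I_def by simp
    moreover have "x \<in> outside (T \<union> U) \<union> (T \<union> U)" if "x \<in> S" for x
      using S_out ST that by auto
    then have "I \<inter> S = {}"
      unfolding I_def by (metis UnE disjoint_iff inside_Int_outside inside_no_overlap)
    ultimately show ?thesis
      by auto
  qed
  \<comment> \<open>\<open>V\<close> is a piece of the boundary of \<open>I\<close>: if it lies outside \<open>C\<close>, then so do points of the
     connected set \<open>I\<close>, hence all of them.\<close>
  have I_outside: "I \<subseteq> outside C"
    if C: "closed C" "C \<subseteq> S \<union> T \<union> U" and V: "V \<noteq> {}" "V \<subseteq> outside C" "V \<subseteq> T \<union> U" for C V
  proof -
    obtain q where q: "q \<in> V" using V by blast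
    then have "q \<in> closure I"
      using J(3) V(3) by (auto simp: frontier_def)
    moreover have "open (outside C)" "q \<in> outside C"
      using C q V by (auto simp: open_outside)
    ultimately have "I \<inter> outside C \<noteq> {}"
      using open_Int_closure_eq_empty by blast
    have "I \<inter> C = {}"
      using I_disj C(2) by blast
    then have "I \<subseteq> inside C \<or> I \<subseteq> outside C"
      using connected_inside_or_outside J(1) C(1) by blast
    then show ?thesis
      using \<open>I \<inter> outside C \<noteq> {}\<close> inside_Int_outside[of C]
      by (metis disjoint_iff subset_iff)
  qed
  have I1: "I \<subseteq> outside (S \<union> T)"
    by (rule I_outside[of _ "U - {a, b}"])
      (use closed U_out arc_between_interior_nonempty[OF U] in \<open>simp_all add: subset_iff closed_Un\<close>)
  have I2: "I \<subseteq> outside (S \<union> U)"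
    by (rule I_outside[of _ "T - {a, b}"])
      (use closed T_out arc_between_interior_nonempty[OF T] in \<open>simp_all add: subset_iff closed_Un\<close>)
  obtain u where u: "u \<in> I" using J(4) by blast
  have "compact (S \<union> T \<union> U)"
    using S T U by (intro compact_Un) (metis arc_betweenD(1))+
  then have "outside (S \<union> T \<union> U) \<noteq> {}"
    using compact_imp_bounded outside_bounded_nonempty by blast
  then obtain w where w: "w \<in> outside (S \<union> T \<union> U)" by blast
  have w': "w \<in> outside (S \<union> T)" "w \<in> outside (S \<union> U)"
    using w outside_mono[of "S \<union> T" "S \<union> T \<union> U"] outside_mono[of "S \<union> U" "S \<union> T \<union> U"] by auto
  have "connected_component (- ((S \<union> T) \<union> (S \<union> U))) w u"
  proof (rule Janiszewski)
    show "compact (S \<union> T)" "closed (S \<union> U)"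
      using arc_betweenD(1)[OF S] arc_betweenD(1)[OF T] closed by (simp_all add: compact_Un closed_Un)
    have "(S \<union> T) \<inter> (S \<union> U) = S \<union> (T \<inter> U)"
      by blast
    moreover have "S \<union> (T \<inter> U) = S"
      unfolding TU using arc_betweenD(4,5)[OF S] by blast
    ultimately show "connected ((S \<union> T) \<inter> (S \<union> U))"
      using arc_betweenD(2)[OF S] by presburger
    show "connected_component (- (S \<union> T)) w u"
      using connected_component_Compl_outside[OF Jordan_two_arcs(2)[OF S T ST] w'(1)] I1 u by blast
    show "connected_component (- (S \<union> U)) w u"
      using connected_component_Compl_outside[OF Jordan_two_arcs(2)[OF S U SU] w'(2)] I2 u by blast
  qed
  moreover have "(S \<union> T) \<union> (S \<union> U) = S \<union> T \<union> U" by blast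
  ultimately have "u \<in> outside (S \<union> T \<union> U)"
    using w outside_same_component by metis
  then have "u \<in> outside (T \<union> U)"
    using outside_mono[of "T \<union> U" "S \<union> T \<union> U"] by blast
  then show False
    using u inside_Int_outside[of "T \<union> U"] unfolding I_def by blast
qed

lemma split_inside_two_arcs:
  assumes S: "arc_between S a b" and T: "arc_between T a b" and U: "arc_between U a b"
    and ST: "S \<inter> T = {a, b}" and SU: "S \<inter> U = {a, b}" and TU: "T \<inter> U = {a, b}"
    and U_in: "U \<inter> inside (S \<union> T) \<noteq> {}"
  shows "inside (S \<union> U) \<inter> inside (T \<union> U) = {}"
    "inside (S \<union> U) \<union> inside (T \<union> U) \<union> (U - {a, b}) = inside (S \<union> T)"
proof -
  obtain g h k where ghk:
    "arc g" "path_image g = S" "pathstart g = a" "pathfinish g = b"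
    "arc h" "path_image h = T" "pathstart h = a" "pathfinish h = b"
    "arc k" "path_image k = U" "pathstart k = a" "pathfinish k = b"
    using S T U unfolding arc_between_def by auto
  have "inside (S \<union> U) \<inter> inside (T \<union> U) = {} \<and>
    inside (S \<union> U) \<union> inside (T \<union> U) \<union> (U - {a, b}) = inside (S \<union> T)"
    by (rule split_inside_simple_closed_curve[of g a b h k])
      (use ghk ST SU TU U_in arc_betweenD(6)[OF S] in \<open>simp_all add: arc_imp_simple_path\<close>)
  then show "inside (S \<union> U) \<inter> inside (T \<union> U) = {}"
    "inside (S \<union> U) \<union> inside (T \<union> U) \<union> (U - {a, b}) = inside (S \<union> T)"
    by simp_all
qed

section \<open>Plane drawings of the complete graph on four vertices\<close>

text \<open>
  The edge \<open>ab\<close> and the two detours \<open>acb\<close> and \<open>adb\<close> form a theta graph. If a detour were the arc that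
  runs inside, then \<open>c\<close> would be inside the triangle \<open>abd\<close>, or \<open>d\<close> inside the triangle \<open>abc\<close>.
  So it is the edge \<open>ab\<close> that runs inside, as a chord of the quadrilateral \<open>acbd\<close>.
\<close>

lemma K4_drawing_chord_inside:
  assumes ab: "arc_between Sab a b" and ac: "arc_between Sac a c" and ad: "arc_between Sad a d"
    and bc: "arc_between Sbc b c" and bd: "arc_between Sbd b d"
    and dist: "c \<noteq> d"
    and disj: "Sac \<inter> Sbd = {}" "Sad \<inter> Sbc = {}"
    and meet: "Sab \<inter> Sac = {a}" "Sab \<inter> Sad = {a}" "Sac \<inter> Sad = {a}"
      "Sab \<inter> Sbc = {b}" "Sab \<inter> Sbd = {b}" "Sbc \<inter> Sbd = {b}"
      "Sac \<inter> Sbc = {c}" "Sad \<inter> Sbd = {d}"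
    and c_out: "c \<notin> inside (Sab \<union> Sad \<union> Sbd)" and d_out: "d \<notin> inside (Sab \<union> Sac \<union> Sbc)"
  shows "Sab - {a, b} \<subseteq> inside (Sac \<union> Sbc \<union> Sad \<union> Sbd)"
proof -
  have T: "arc_between (Sac \<union> Sbc) a b"
    using arc_between_join[OF ac arc_between_sym[OF bc]] meet by auto
  have U: "arc_between (Sad \<union> Sbd) a b"
    using arc_between_join[OF ad arc_between_sym[OF bd]] meet by auto
  have neq: "a \<noteq> c" "b \<noteq> c" "a \<noteq> d" "b \<noteq> d"
    using ac bc ad bd arc_betweenD(6) by metis+
  have 1: "Sab \<inter> (Sac \<union> Sbc) = {a, b}" "Sab \<inter> (Sad \<union> Sbd) = {a, b}"
    using meet(1,2,4,5) by blast+
  have 2: "(Sac \<union> Sbc) \<inter> (Sad \<union> Sbd) = {a, b}"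
    using meet(3,6) disj by blast
  have "c \<in> Sac \<union> Sbc - {a, b}" "d \<in> Sad \<union> Sbd - {a, b}"
    using arc_betweenD(5)[OF ac] arc_betweenD(5)[OF ad] neq by auto
  then show ?thesis
    using theta_arc_inside[OF ab T U 1 2] c_out d_out unfolding Un_assoc by blast
qed

text \<open>
  In a drawing of the complete graph on four vertices, some vertex is inside the triangle of the
  other three. Otherwise both \<open>ab\<close> and \<open>cd\<close> are chords inside the quadrilateral \<open>acbd\<close>. The chord
  \<open>ab\<close> splits the inside of the quadrilateral into the insides of the triangles \<open>abc\<close> and \<open>abd\<close>; as
  \<open>cd\<close> does not meet \<open>ab\<close>, it stays in one of them, which forces one of its ends, \<open>d\<close> or \<open>c\<close>, into
  the inside of that triangle. The lemma speaks of arcs and not of edges so that it also applies to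
  subdivisions.
\<close>

lemma K4_drawing_vertex_inside:
  assumes ab: "arc_between Sab a b" and ac: "arc_between Sac a c" and ad: "arc_between Sad a d"
    and bc: "arc_between Sbc b c" and bd: "arc_between Sbd b d" and cd: "arc_between Scd c d"
    and disj: "Sab \<inter> Scd = {}" "Sac \<inter> Sbd = {}" "Sad \<inter> Sbc = {}"
    and meet: "Sab \<inter> Sac = {a}" "Sab \<inter> Sad = {a}" "Sac \<inter> Sad = {a}"
      "Sab \<inter> Sbc = {b}" "Sab \<inter> Sbd = {b}" "Sbc \<inter> Sbd = {b}"
      "Sac \<inter> Sbc = {c}" "Sac \<inter> Scd = {c}" "Sbc \<inter> Scd = {c}"
      "Sad \<inter> Sbd = {d}" "Sad \<inter> Scd = {d}" "Sbd \<inter> Scd = {d}"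
  shows "a \<in> inside (Sbc \<union> Sbd \<union> Scd) \<or> b \<in> inside (Sac \<union> Sad \<union> Scd) \<or>
    c \<in> inside (Sab \<union> Sad \<union> Sbd) \<or> d \<in> inside (Sab \<union> Sac \<union> Sbc)"
proof (rule ccontr)
  assume "\<not> ?thesis"
  then have out: "a \<notin> inside (Sbc \<union> Sbd \<union> Scd)" "b \<notin> inside (Sac \<union> Sad \<union> Scd)"
    "c \<notin> inside (Sab \<union> Sad \<union> Sbd)" "d \<notin> inside (Sab \<union> Sac \<union> Sbc)"
    by auto
  have neq: "a \<noteq> b" "a \<noteq> c" "a \<noteq> d" "b \<noteq> c" "b \<noteq> d" "c \<noteq> d"
    using ab ac bc ad bd cd arc_betweenD(6) by metis+
  let ?C = "Sac \<union> Sbc \<union> Sad \<union> Sbd"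
  have ab_in: "Sab - {a, b} \<subseteq> inside ?C"
    by (rule K4_drawing_chord_inside[OF ab ac ad bc bd]) (use neq(6) disj(2,3) meet(1-7,10) out(3,4) in simp_all)
  have out': "a \<notin> inside (Scd \<union> Sbc \<union> Sbd)" "b \<notin> inside (Scd \<union> Sac \<union> Sad)"
    using out(1,2) by (metis Un_commute Un_assoc)+
  have "Scd - {c, d} \<subseteq> inside (Sac \<union> Sad \<union> Sbc \<union> Sbd)"
    by (rule K4_drawing_chord_inside[OF cd ac[THEN arc_between_sym] bc[THEN arc_between_sym]
          ad[THEN arc_between_sym] bd[THEN arc_between_sym]])
      (use neq(1) disj(2,3) meet(3,6-12) out' in \<open>simp_all add: Int_commute\<close>)
  then have cd_in: "Scd - {c, d} \<subseteq> inside ?C"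
    by (simp add: Un_commute Un_left_commute Un_assoc)
  have T: "arc_between (Sac \<union> Sbc) a b"
    using arc_between_join[OF ac arc_between_sym[OF bc]] meet by auto
  have U: "arc_between (Sad \<union> Sbd) a b"
    using arc_between_join[OF ad arc_between_sym[OF bd]] meet by auto
  have "Sab \<inter> (Sac \<union> Sbc) = {a, b}" "Sab \<inter> (Sad \<union> Sbd) = {a, b}"
    using meet(1,2,4,5) by blast+
  then have 1: "(Sac \<union> Sbc) \<inter> Sab = {a, b}" "(Sad \<union> Sbd) \<inter> Sab = {a, b}"
    by (simp_all add: Int_commute)
  have 2: "(Sac \<union> Sbc) \<inter> (Sad \<union> Sbd) = {a, b}"
    using meet(3,6) disj(2,3) by blast
  have "Sab \<inter> inside ((Sac \<union> Sbc) \<union> (Sad \<union> Sbd)) \<noteq> {}"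
    using ab_in arc_between_interior_nonempty[OF ab] unfolding Un_assoc by blast
  note split = split_inside_two_arcs[OF T U ab 2 1(1) 1(2) this]
  have "Scd - {c, d} \<subseteq> inside (Sac \<union> Sbc \<union> Sab) \<union> inside (Sad \<union> Sbd \<union> Sab)"
    using cd_in disj(1) split(2) unfolding Un_assoc by blast
  then have cases: "Scd - {c, d} \<subseteq> inside (Sac \<union> Sbc \<union> Sab) \<or>
      Scd - {c, d} \<subseteq> inside (Sad \<union> Sbd \<union> Sab)"
    using connectedD[OF arc_betweenD(3)[OF cd] Jordan_two_arcs(5)[OF T ab 1(1)]
        Jordan_two_arcs(5)[OF U ab 1(2)]] split(1)
    by blast
  have closed: "closed (Sac \<union> Sbc \<union> Sab)" "closed (Sad \<union> Sbd \<union> Sab)"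
    using arc_betweenD(1) T U ab by (auto intro!: compact_imp_closed)
  have d_lim: "d \<in> closure (Scd - {c, d})" and c_lim: "c \<in> closure (Scd - {c, d})"
    using arc_between_endpoint_limit[OF cd] arc_between_endpoint_limit[OF arc_between_sym[OF cd]]
    by (auto simp: insert_commute)
  from cases show False
  proof
    assume "Scd - {c, d} \<subseteq> inside (Sac \<union> Sbc \<union> Sab)"
    then have "d \<in> (Sac \<union> Sbc \<union> Sab) \<union> inside (Sac \<union> Sbc \<union> Sab)"
      using closure_inside_subset[OF closed(1)] closure_mono d_lim by blast
    moreover have "d \<notin> Sac \<union> Sbc \<union> Sab"
      using meet(8,9) disj(1) arc_betweenD(5)[OF cd] neq(6) by (metis IntI UnE empty_iff singletonD)
    moreover have "Sac \<union> Sbc \<union> Sab = Sab \<union> Sac \<union> Sbc"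
      by blast
    ultimately show False
      using out(4) by (metis UnE)
  next
    assume "Scd - {c, d} \<subseteq> inside (Sad \<union> Sbd \<union> Sab)"
    then have "c \<in> (Sad \<union> Sbd \<union> Sab) \<union> inside (Sad \<union> Sbd \<union> Sab)"
      using closure_inside_subset[OF closed(2)] closure_mono c_lim by blast
    moreover have "c \<notin> Sad \<union> Sbd \<union> Sab"
      using meet(11,12) disj(1) arc_betweenD(4)[OF cd] neq(6) by (metis IntI UnE empty_iff singletonD)
    moreover have "Sad \<union> Sbd \<union> Sab = Sab \<union> Sad \<union> Sbd"
      by blast
    ultimately show False
      using out(3) by (metis UnE)
  qed
qed

section \<open>Subgraphs of outerplanar graphs\<close>

text \<open>
  An embedding need not be induced: \<open>H\<close> may have more edges among the image vertices. The condition that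
  edges consist of vertices is included because records of type \<open>sgraph\<close> do not guarantee it.
\<close>

definition graph_embedding :: "('v \<Rightarrow> 'w) \<Rightarrow> 'v sgraph \<Rightarrow> 'w sgraph \<Rightarrow> bool" where
  "graph_embedding f G H \<longleftrightarrow> edges G \<subseteq> Pow (vertices G) \<and> inj_on f (vertices G) \<and>
     f ` vertices G \<subseteq> vertices H \<and> (\<forall>e\<in>edges G. f ` e \<in> edges H)"

lemma graph_embeddingD:
  assumes "graph_embedding f G H"
  shows "e \<in> edges G \<Longrightarrow> e \<subseteq> vertices G" "inj_on f (vertices G)"
    "f ` vertices G \<subseteq> vertices H" "e \<in> edges G \<Longrightarrow> f ` e \<in> edges H"
  using assms unfolding graph_embedding_def by blast+

lemma graph_embedding_comp:
  assumes f: "graph_embedding f G H" and g: "graph_embedding g H K"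
  shows "graph_embedding (g \<circ> f) G K"
  unfolding graph_embedding_def
proof (intro conjI ballI)
  show "edges G \<subseteq> Pow (vertices G)"
    using graph_embeddingD(1)[OF f] by blast
  show "inj_on (g \<circ> f) (vertices G)"
    by (rule comp_inj_on[OF graph_embeddingD(2)[OF f]])
      (rule inj_on_subset[OF graph_embeddingD(2)[OF g] graph_embeddingD(3)[OF f]])
  show "(g \<circ> f) ` vertices G \<subseteq> vertices K"
    using graph_embeddingD(3)[OF f] graph_embeddingD(3)[OF g] by fastforce
  show "(g \<circ> f) ` e \<in> edges K" if "e \<in> edges G" for e
    using graph_embeddingD(4)[OF g graph_embeddingD(4)[OF f that]] by (simp add: image_comp)
qed

lemma graph_embedding_line_graph:
  assumes f: "graph_embedding f G H"
  shows "graph_embedding ((`) f) (line_graph G) (line_graph H)"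
  unfolding graph_embedding_def
proof (intro conjI ballI)
  have "edges G \<subseteq> Pow (vertices G)"
    using graph_embeddingD(1)[OF f] by blast
  then have inj: "inj_on ((`) f) (edges G)"
    using inj_on_image_Pow[OF graph_embeddingD(2)[OF f]] inj_on_subset by blast
  show "edges (line_graph G) \<subseteq> Pow (vertices (line_graph G))"
    by (auto simp: line_graph_def)
  show "inj_on ((`) f) (vertices (line_graph G))"
    using inj by (simp add: line_graph_def)
  show "(`) f ` vertices (line_graph G) \<subseteq> vertices (line_graph H)"
    using graph_embeddingD(4)[OF f] by (auto simp: line_graph_def)
  fix E assume "E \<in> edges (line_graph G)"
  then obtain d e where de: "E = {d, e}" "d \<in> edges G" "e \<in> edges G" "d \<noteq> e" "d \<inter> e \<noteq> {}"
    by (auto simp: line_graph_def)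
  have "f ` d \<noteq> f ` e" "f ` d \<inter> f ` e \<noteq> {}"
    using de inj by (auto dest: inj_onD)
  moreover have "f ` d \<in> edges H" "f ` e \<in> edges H"
    using de graph_embeddingD(4)[OF f] by blast+
  ultimately have "{f ` d, f ` e} \<in> edges (line_graph H)"
    unfolding line_graph_def sgraph.simps by blast
  then show "(`) f ` E \<in> edges (line_graph H)"
    unfolding de(1) by simp
qed

text \<open>
  Removing points from a drawing enlarges the outside, so a remaining point stays a limit of outside
  points, and it is not itself outside. Hence subgraphs inherit outerplanar drawings.
\<close>

lemma frontier_outside_mono:
  assumes "S \<subseteq> T" "x \<in> S" "x \<in> frontier (outside T)"
  shows "x \<in> frontier (outside S)"
proof -
  have "x \<in> closure (outside S)"
    using assms closure_mono[OF outside_mono[OF assms(1)]] by (auto simp: frontier_def)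
  moreover have "x \<notin> interior (outside S)"
    using assms(2) interior_subset outside_no_overlap by blast
  ultimately show ?thesis
    by (simp add: frontier_def)
qed

lemma outerplanar_graph_embedding:
  assumes "outerplanar H" "graph_embedding f G H"
  shows "outerplanar G"
proof -
  have f: "edges G \<subseteq> Pow (vertices G)" "inj_on f (vertices G)" "f ` vertices G \<subseteq> vertices H"
    and fe: "\<And>e. e \<in> edges G \<Longrightarrow> f ` e \<in> edges H"
    using assms(2) unfolding graph_embedding_def by auto
  obtain p \<gamma> where drawing: "plane_drawing H p \<gamma>"
    and outer: "p ` vertices H \<subseteq> frontier (outside (drawing_points H p \<gamma>))"
    using assms(1) unfolding outerplanar_def by blast
  have p: "inj_on p (vertices H)"
    and arc: "\<And>e. e \<in> edges H \<Longrightarrow> arc (\<gamma> e) \<and> {pathstart (\<gamma> e), pathfinish (\<gamma> e)} = p ` e"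
    and vert: "\<And>e. e \<in> edges H \<Longrightarrow> path_image (\<gamma> e) \<inter> p ` vertices H = p ` e"
    and meet: "\<And>e e'. e \<in> edges H \<Longrightarrow> e' \<in> edges H \<Longrightarrow> e \<noteq> e' \<Longrightarrow>
        path_image (\<gamma> e) \<inter> path_image (\<gamma> e') = p ` (e \<inter> e')"
    using drawing by (simp_all add: plane_drawing_def)
  let ?p = "p \<circ> f" and ?\<gamma> = "\<lambda>e. \<gamma> (f ` e)"
  have "plane_drawing G ?p ?\<gamma>"
    unfolding plane_drawing_def
  proof (intro conjI ballI impI)
    show "inj_on ?p (vertices G)"
      using comp_inj_on[OF f(2)] inj_on_subset[OF p f(3)] by blast
    fix e assume e: "e \<in> edges G"
    show "arc (?\<gamma> e)" "{pathstart (?\<gamma> e), pathfinish (?\<gamma> e)} = ?p ` e"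
      using arc[OF fe[OF e]] by (simp_all add: image_comp)
    have "?p ` e \<subseteq> ?p ` vertices G" "?p ` vertices G \<subseteq> p ` vertices H"
      using f e by auto
    moreover have "path_image (?\<gamma> e) \<inter> p ` vertices H = ?p ` e"
      using vert[OF fe[OF e]] by (simp add: image_comp)
    ultimately show "path_image (?\<gamma> e) \<inter> ?p ` vertices G = ?p ` e"
      by blast
    fix e' assume e': "e' \<in> edges G" "e \<noteq> e'"
    have sub: "e \<subseteq> vertices G" "e' \<subseteq> vertices G"
      using e e' f(1) by auto
    have "f ` e \<noteq> f ` e'"
      using inj_on_image_eq_iff[OF f(2) sub] e'(2) by blast
    moreover have "f ` (e \<inter> e') = f ` e \<inter> f ` e'"
      using inj_on_image_Int[OF f(2) sub] by blast
    ultimately show "path_image (?\<gamma> e) \<inter> path_image (?\<gamma> e') = ?p ` (e \<inter> e')"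
      using meet[OF fe[OF e] fe[OF e'(1)]] by (metis image_comp)
  qed
  moreover have "?p ` vertices G \<subseteq> frontier (outside (drawing_points G ?p ?\<gamma>))"
  proof
    fix x assume x: "x \<in> ?p ` vertices G"
    have "drawing_points G ?p ?\<gamma> \<subseteq> drawing_points H p \<gamma>"
      unfolding drawing_points_def
    proof (rule Un_mono)
      show "?p ` vertices G \<subseteq> p ` vertices H"
        using f(3) by (metis image_comp image_mono)
      show "(\<Union>e\<in>edges G. path_image (?\<gamma> e)) \<subseteq> (\<Union>e\<in>edges H. path_image (\<gamma> e))"
        using fe by blast
    qed
    moreover have "x \<in> drawing_points G ?p ?\<gamma>"
      using x by (simp add: drawing_points_def)
    moreover have "x \<in> frontier (outside (drawing_points H p \<gamma>))"
    proof -
      have "x \<in> p ` vertices H"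
        using x f(3) by auto
      then show ?thesis
        using outer by blast
    qed
    ultimately show "x \<in> frontier (outside (drawing_points G ?p ?\<gamma>))"
      by (rule frontier_outside_mono)
  qed
  ultimately show ?thesis
    unfolding outerplanar_def by (intro exI conjI)
qed

section \<open>Graphs without crossing chords are outerplanar\<close>

text \<open>
  Vertices are placed on the parabola \<open>y = x\<^sup>2\<close> and edges are drawn as chords. On the chord between
  the abscissas \<open>a\<close> and \<open>b\<close> the height above the parabola is \<open>(x - a) * (b - x)\<close>, so that all questions
  about intersections become questions about these products.
\<close>

definition parabola_point :: "real \<Rightarrow> complex" where
  "parabola_point x = Complex x (x\<^sup>2)"

lemma parabola_point_sel [simp]:
  "Re (parabola_point x) = x" "Im (parabola_point x) = x\<^sup>2"
  by (simp_all add: parabola_point_def)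

lemma parabola_point_inject [simp]: "parabola_point x = parabola_point y \<longleftrightarrow> x = y"
  by (metis parabola_point_sel(1))

abbreviation parabola_chord :: "real \<Rightarrow> real \<Rightarrow> complex set" where
  "parabola_chord a b \<equiv> closed_segment (parabola_point a) (parabola_point b)"

lemma parabola_chordD:
  assumes "z \<in> parabola_chord a b" "a < b"
  shows "a \<le> Re z" "Re z \<le> b" "Im z - (Re z)\<^sup>2 = (Re z - a) * (b - Re z)"
proof -
  obtain u where u: "0 \<le> u" "u \<le> 1"
    "z = (1 - u) *\<^sub>R parabola_point a + u *\<^sub>R parabola_point b"
    using assms(1) unfolding in_segment by blast
  have re: "Re z = a + u * (b - a)" and im: "Im z = a\<^sup>2 + u * (b\<^sup>2 - a\<^sup>2)"
    unfolding u(3) by (simp_all add: algebra_simps)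
  have "0 \<le> u * (b - a)" "u * (b - a) \<le> 1 * (b - a)"
    using u assms(2) by (auto intro: mult_right_mono)
  then show "a \<le> Re z" "Re z \<le> b"
    using re by auto
  show "Im z - (Re z)\<^sup>2 = (Re z - a) * (b - Re z)"
    unfolding re im by (simp add: power2_eq_square algebra_simps)
qed

text \<open>
  A common point that is on the parabola is a common end. A common point strictly above the parabola
  lies strictly between the ends of both chords, so the two intervals overlap and, being
  non-interlaced, are nested; but for nested intervals the heights \<open>(x - a) * (b - x)\<close> and
  \<open>(x - c) * (d - x)\<close> can agree only if the intervals do.
\<close>

lemma noncrossing_chords_meet:
  assumes "a < b" "c < d" "\<not> (a < c \<and> c < b \<and> b < d)" "\<not> (c < a \<and> a < d \<and> d < b)"
    and "(a, b) \<noteq> (c, d)"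
  shows "parabola_chord a b \<inter> parabola_chord c d = parabola_point ` ({a, b} \<inter> {c, d})"
proof
  show "parabola_point ` ({a, b} \<inter> {c, d}) \<subseteq> parabola_chord a b \<inter> parabola_chord c d"
    by auto
  show "parabola_chord a b \<inter> parabola_chord c d \<subseteq> parabola_point ` ({a, b} \<inter> {c, d})"
  proof
    fix z assume "z \<in> parabola_chord a b \<inter> parabola_chord c d"
    then have z: "z \<in> parabola_chord a b" "z \<in> parabola_chord c d" by auto
    define x where "x = Re z"
    note ab = parabola_chordD[OF z(1) assms(1), folded x_def]
    note cd = parabola_chordD[OF z(2) assms(2), folded x_def]
    have eq: "(x - a) * (b - x) = (x - c) * (d - x)"
      using ab(3) cd(3) by simp
    have "x = a \<or> x = b"
    proof (rule ccontr)
      assume "\<not> (x = a \<or> x = b)"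
      then have x: "a < x" "x < b" using ab by auto
      then have "0 < (x - c) * (d - x)"
        using eq by (metis diff_gt_0_iff_gt mult_pos_pos)
      then have x': "c < x" "x < d"
        using cd(1,2) by (auto simp: zero_less_mult_iff)
      consider "a \<le> c" "d \<le> b" | "c \<le> a" "b \<le> d"
        using assms(3,4) x x' by linarith
      then show False
      proof cases
        case 1
        have "(x - c) * (d - x) \<le> (x - c) * (b - x)" "(x - c) * (b - x) \<le> (x - a) * (b - x)"
          using 1 x x' by (auto intro!: mult_left_mono mult_right_mono)
        then have "(x - c) * (b - d) = 0" "(b - x) * (c - a) = 0"
          using eq by (auto simp: algebra_simps)
        then show False
          using x x' assms(5) by auto
      next
        case 2
        have "(x - a) * (b - x) \<le> (x - a) * (d - x)" "(x - a) * (d - x) \<le> (x - c) * (d - x)"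
          using 2 x x' by (auto intro!: mult_left_mono mult_right_mono)
        then have "(x - a) * (d - b) = 0" "(d - x) * (a - c) = 0"
          using eq by (auto simp: algebra_simps)
        then show False
          using x x' assms(5) by auto
      qed
    qed
    moreover from this have "x = c \<or> x = d"
      using eq by auto
    moreover have "z = parabola_point x"
      using ab(3) \<open>x = a \<or> x = b\<close> by (auto simp: complex_eq_iff x_def)
    ultimately show "z \<in> parabola_point ` ({a, b} \<inter> {c, d})"
      by auto
  qed
qed

text \<open>
  The region on and above the parabola is convex, so everything below is outside, and each point of
  the parabola is a limit of points below it.
\<close>

lemma frontier_outside_below_parabola:
  assumes "D \<subseteq> {z. (Re z)\<^sup>2 \<le> Im z}" "parabola_point x \<in> D"
  shows "parabola_point x \<in> frontier (outside D)"
proof -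
  let ?K = "{z. (Re z)\<^sup>2 \<le> Im z}"
  have "convex ?K"
  proof (rule convexI)
    fix w z :: complex and u v :: real
    assume wz: "w \<in> ?K" "z \<in> ?K" and uv: "0 \<le> u" "0 \<le> v" "u + v = 1"
    have v: "v = 1 - u" using uv by simp
    have "u * (Re w)\<^sup>2 + v * (Re z)\<^sup>2 - (u * Re w + v * Re z)\<^sup>2 = u * v * (Re w - Re z)\<^sup>2"
      unfolding v by (simp add: power2_eq_square algebra_simps)
    then have "(u * Re w + v * Re z)\<^sup>2 \<le> u * (Re w)\<^sup>2 + v * (Re z)\<^sup>2"
      using uv by (metis diff_ge_0_iff_ge mult_nonneg_nonneg zero_le_power2)
    also have "\<dots> \<le> u * Im w + v * Im z"
      using wz uv by (intro add_mono mult_left_mono) auto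
    finally show "u *\<^sub>R w + v *\<^sub>R z \<in> ?K" by simp
  qed
  then have "outside ?K = - ?K"
    by (intro outside_convex) auto
  then have below: "- ?K \<subseteq> outside D"
    using outside_mono[OF assms(1)] by simp
  have "parabola_point x \<in> closure (- ?K)"
    unfolding closure_approachable
  proof (intro allI impI)
    fix e :: real assume "0 < e"
    then have "Complex x (x\<^sup>2 - e / 2) \<in> - ?K" "dist (Complex x (x\<^sup>2 - e / 2)) (parabola_point x) < e"
      by (auto simp: dist_norm parabola_point_def complex_norm complex_diff)
    then show "\<exists>y\<in>- ?K. dist y (parabola_point x) < e" by blast
  qed
  then have "parabola_point x \<in> closure (outside D)"
    using closure_mono[OF below] by blast
  moreover have "parabola_point x \<notin> interior (outside D)"
    using assms(2) interior_subset outside_no_overlap by blast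
  ultimately show ?thesis
    by (simp add: frontier_def)
qed

text \<open>
  A graph whose vertices can be numbered without interlaced edges is drawn with chords of the
  parabola; all its vertices are then visible from below.
\<close>

lemma noncrossing_outerplanar:
  fixes G :: "nat sgraph"
  assumes edge: "\<And>e. e \<in> edges G \<Longrightarrow> e \<subseteq> vertices G \<and> card e = 2"
    and noncrossing: "\<And>a b c d. {a, b} \<in> edges G \<Longrightarrow> {c, d} \<in> edges G \<Longrightarrow>
      \<not> (a < c \<and> c < b \<and> b < d)"
  shows "outerplanar G"
proof -
  define p :: "nat \<Rightarrow> complex" where "p v = parabola_point (real v)" for v
  define \<gamma> where "\<gamma> e = linepath (p (Min e)) (p (Max e))" for e
  have edgeE: "\<exists>a b. a \<in> vertices G \<and> b \<in> vertices G \<and> a < b \<and> e = {a, b} \<and>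
      \<gamma> e = linepath (p a) (p b) \<and> path_image (\<gamma> e) = parabola_chord (real a) (real b)"
    if e: "e \<in> edges G" for e
  proof -
    obtain a b where ab: "a \<in> vertices G" "b \<in> vertices G" "a < b" "e = {a, b}"
    proof -
      obtain x y where "e = {x, y}" "x \<noteq> y"
        using edge[OF e] by (auto simp: card_2_iff)
      then show ?thesis
        using edge[OF e] that[of x y] that[of y x] by (cases "x < y") auto
    qed
    then have "Min e = a" "Max e = b" by (auto simp: min_def max_def)
    then show ?thesis
      using ab by (auto simp: \<gamma>_def p_def)
  qed
  have inj_p: "inj p"
    by (auto simp: inj_def p_def)
  have "plane_drawing G p \<gamma>"
    unfolding plane_drawing_def
  proof (intro conjI ballI impI)
    show "inj_on p (vertices G)"
      using inj_p by (rule inj_on_subset) simp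
    fix e assume "e \<in> edges G"
    then obtain a b where ab: "{a, b} \<in> edges G" "a \<in> vertices G" "b \<in> vertices G" "a < b"
        "e = {a, b}" "\<gamma> e = linepath (p a) (p b)"
        "path_image (\<gamma> e) = parabola_chord (real a) (real b)"
      using edgeE by metis
    have ab': "real a < real b" using ab(4) by simp
    show "arc (\<gamma> e)" "{pathstart (\<gamma> e), pathfinish (\<gamma> e)} = p ` e"
      unfolding ab(6) using ab(4,5) by (auto simp: p_def intro!: arc_linepath)
    have on_chord: "v = a \<or> v = b" if "p v \<in> parabola_chord (real a) (real b)" for v
      using parabola_chordD(3)[OF that ab'] by (auto simp: p_def)
    show "path_image (\<gamma> e) \<inter> p ` vertices G = p ` e"
      unfolding ab(7) using on_chord ab(2,3,5) by (auto simp: p_def)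
    fix f assume "f \<in> edges G" and "e \<noteq> f"
    then obtain c d where cd: "{c, d} \<in> edges G" "c < d" "f = {c, d}"
        "path_image (\<gamma> f) = parabola_chord (real c) (real d)"
      using edgeE by metis
    have "parabola_chord (real a) (real b) \<inter> parabola_chord (real c) (real d) =
        parabola_point ` ({real a, real b} \<inter> {real c, real d})"
      by (rule noncrossing_chords_meet)
        (use ab(1,4,5) cd(1-3) \<open>e \<noteq> f\<close> noncrossing[of a b c d] noncrossing[of c d a b] in auto)
    also have "{real a, real b} \<inter> {real c, real d} = real ` (e \<inter> f)"
      unfolding ab(5) cd(3) by auto
    finally show "path_image (\<gamma> e) \<inter> path_image (\<gamma> f) = p ` (e \<inter> f)"
      unfolding ab(7) cd(4) image_image p_def .
  qed
  moreover have "p ` vertices G \<subseteq> frontier (outside (drawing_points G p \<gamma>))"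
  proof
    fix x assume x: "x \<in> p ` vertices G"
    have "path_image (\<gamma> e) \<subseteq> {z. (Re z)\<^sup>2 \<le> Im z}" if e: "e \<in> edges G" for e
    proof
      fix z assume z: "z \<in> path_image (\<gamma> e)"
      obtain a b where ab: "a < b" "path_image (\<gamma> e) = parabola_chord (real a) (real b)"
        using edgeE[OF e] by blast
      then have chord: "z \<in> parabola_chord (real a) (real b)" and less: "real a < real b"
        using z by auto
      have "0 \<le> (Re z - real a) * (real b - Re z)"
        using parabola_chordD(1,2)[OF chord less] by simp
      then show "z \<in> {z. (Re z)\<^sup>2 \<le> Im z}"
        using parabola_chordD(3)[OF chord less] by simp
    qed
    then have "drawing_points G p \<gamma> \<subseteq> {z. (Re z)\<^sup>2 \<le> Im z}"
      by (auto simp: drawing_points_def p_def)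
    moreover have "x \<in> drawing_points G p \<gamma>"
      using x by (simp add: drawing_points_def)
    ultimately show "x \<in> frontier (outside (drawing_points G p \<gamma>))"
      using x frontier_outside_below_parabola by (auto simp: p_def)
  qed
  ultimately show ?thesis
    unfolding outerplanar_def by blast
qed

section \<open>Line graphs that are not outerplanar\<close>

lemma edge_arc_between:
  assumes "plane_drawing G p \<gamma>" "{u, v} \<in> edges G"
  shows "arc_between (path_image (\<gamma> {u, v})) (p u) (p v)"
proof -
  have "arc (\<gamma> {u, v})" "{pathstart (\<gamma> {u, v}), pathfinish (\<gamma> {u, v})} = {p u, p v}"
    using assms by (simp_all add: plane_drawing_def)
  then have "arc_between (path_image (\<gamma> {u, v})) (p u) (p v) \<or>
      arc_between (path_image (\<gamma> {u, v})) (p v) (p u)"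
    unfolding arc_between_def doubleton_eq_iff by blast
  then show ?thesis
    using arc_between_sym by blast
qed

text \<open>
  This is how outerplanarity is exploited: a vertex on the boundary of the unbounded region is never
  inside a closed curve that is part of the drawing.
\<close>

lemma frontier_outside_not_inside:
  fixes S D :: "complex set"
  assumes "x \<in> frontier (outside D)" "S \<subseteq> D" "compact S"
  shows "x \<notin> inside S"
proof -
  have "x \<in> closure (outside S)"
    using assms(1) closure_mono[OF outside_mono[OF assms(2)]] by (auto simp: frontier_def)
  then have "x \<in> S \<union> outside S"
    using closure_outside_subset[OF compact_imp_closed[OF assms(3)]] by blast
  then show ?thesis
    using inside_Int_outside[of S] inside_no_overlap[of S] by blast
qed

text \<open>
  In any drawing some vertex would be inside the triangle of the other three.
\<close>

lemma K4_not_outerplanar: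
  assumes V: "{a, b, c, d} \<subseteq> vertices G" and dist: "distinct [a, b, c, d]"
    and E: "{a, b} \<in> edges G" "{a, c} \<in> edges G" "{a, d} \<in> edges G"
      "{b, c} \<in> edges G" "{b, d} \<in> edges G" "{c, d} \<in> edges G"
  shows "\<not> outerplanar G"
proof
  assume "outerplanar G"
  then obtain p \<gamma> where drawing: "plane_drawing G p \<gamma>"
    and outer: "p ` vertices G \<subseteq> frontier (outside (drawing_points G p \<gamma>))"
    unfolding outerplanar_def by blast
  have meet: "path_image (\<gamma> e) \<inter> path_image (\<gamma> f) = p ` (e \<inter> f)"
    if "e \<in> edges G" "f \<in> edges G" "e \<noteq> f" for e f
    using drawing that by (simp add: plane_drawing_def)
  note arc = edge_arc_between[OF drawing]
  have not_inside: "p v \<notin> inside (path_image (\<gamma> e) \<union> path_image (\<gamma> f) \<union> path_image (\<gamma> g))"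
    if "v \<in> vertices G" "e \<in> edges G" "f \<in> edges G" "g \<in> edges G" for v e f g
  proof (rule frontier_outside_not_inside)
    show "p v \<in> frontier (outside (drawing_points G p \<gamma>))"
      using outer that(1) by blast
    show "path_image (\<gamma> e) \<union> path_image (\<gamma> f) \<union> path_image (\<gamma> g) \<subseteq> drawing_points G p \<gamma>"
      using that unfolding drawing_points_def by blast
    show "compact (path_image (\<gamma> e) \<union> path_image (\<gamma> f) \<union> path_image (\<gamma> g))"
      using drawing that by (intro compact_Un compact_arc_image) (simp_all add: plane_drawing_def)
  qed
  have "p a \<in> inside (path_image (\<gamma> {b, c}) \<union> path_image (\<gamma> {b, d}) \<union> path_image (\<gamma> {c, d})) \<or>
    p b \<in> inside (path_image (\<gamma> {a, c}) \<union> path_image (\<gamma> {a, d}) \<union> path_image (\<gamma> {c, d})) \<or>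
    p c \<in> inside (path_image (\<gamma> {a, b}) \<union> path_image (\<gamma> {a, d}) \<union> path_image (\<gamma> {b, d})) \<or>
    p d \<in> inside (path_image (\<gamma> {a, b}) \<union> path_image (\<gamma> {a, c}) \<union> path_image (\<gamma> {b, c}))"
    by (rule K4_drawing_vertex_inside[OF arc[OF E(1)] arc[OF E(2)] arc[OF E(3)] arc[OF E(4)]
          arc[OF E(5)] arc[OF E(6)]]) (use E dist in \<open>simp_all add: meet doubleton_eq_iff\<close>)
  then show False
    using not_inside V E by simp
qed

text \<open>
  The prism contains a subdivision of the complete graph on \<open>a\<close>, \<open>b\<close>, \<open>c\<close>, \<open>a'\<close>: the path through \<open>b'\<close>
  serves as the edge from \<open>b\<close> to \<open>a'\<close>, and the path through \<open>c'\<close> as the edge from \<open>c\<close> to \<open>a'\<close>.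
\<close>

lemma prism_not_outerplanar:
  assumes V: "{a, b, c, a', b', c'} \<subseteq> vertices G" and dist: "distinct [a, b, c, a', b', c']"
    and E: "{a, b} \<in> edges G" "{a, c} \<in> edges G" "{b, c} \<in> edges G"
      "{a', b'} \<in> edges G" "{a', c'} \<in> edges G"
      "{a, a'} \<in> edges G" "{b, b'} \<in> edges G" "{c, c'} \<in> edges G"
  shows "\<not> outerplanar G"
proof
  assume "outerplanar G"
  then obtain p \<gamma> where drawing: "plane_drawing G p \<gamma>"
    and outer: "p ` vertices G \<subseteq> frontier (outside (drawing_points G p \<gamma>))"
    unfolding outerplanar_def by blast
  define A where "A u v = path_image (\<gamma> {u, v})" for u v
  have meet: "A u v \<inter> A x y = p ` ({u, v} \<inter> {x, y})"
    if "{u, v} \<in> edges G" "{x, y} \<in> edges G" "{u, v} \<noteq> {x, y}" for u v x y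
    using drawing that by (simp add: plane_drawing_def A_def)
  have arc: "arc_between (A u v) (p u) (p v)" if "{u, v} \<in> edges G" for u v
    using edge_arc_between[OF drawing that] by (simp add: A_def)
  have not_inside: "p v \<notin> inside S"
    if "v \<in> vertices G" "compact S" "S \<subseteq> (\<Union>e\<in>edges G. path_image (\<gamma> e))" for v S
    by (rule frontier_outside_not_inside[of _ "drawing_points G p \<gamma>"])
      (use outer that in \<open>auto simp: drawing_points_def\<close>)
  define Sbd where "Sbd = A b b' \<union> A a' b'"
  define Scd where "Scd = A c c' \<union> A a' c'"
  have bd: "arc_between Sbd (p b) (p a')"
    unfolding Sbd_def
    by (rule arc_between_join[OF arc[OF E(7)] arc_between_sym[OF arc[OF E(4)]]])
      (use E dist in \<open>simp add: meet doubleton_eq_iff\<close>)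
  have cd: "arc_between Scd (p c) (p a')"
    unfolding Scd_def
    by (rule arc_between_join[OF arc[OF E(8)] arc_between_sym[OF arc[OF E(5)]]])
      (use E dist in \<open>simp add: meet doubleton_eq_iff\<close>)
  have "p a \<in> inside (A b c \<union> Sbd \<union> Scd) \<or> p b \<in> inside (A a c \<union> A a a' \<union> Scd) \<or>
    p c \<in> inside (A a b \<union> A a a' \<union> Sbd) \<or> p a' \<in> inside (A a b \<union> A a c \<union> A b c)"
    by (rule K4_drawing_vertex_inside[OF arc[OF E(1)] arc[OF E(2)] arc[OF E(6)] arc[OF E(3)] bd cd])
      (use E dist in \<open>simp_all add: Sbd_def Scd_def meet doubleton_eq_iff Int_Un_distrib Int_Un_distrib2\<close>)
  moreover have "compact (A u v)" "A u v \<subseteq> (\<Union>e\<in>edges G. path_image (\<gamma> e))"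
    if "{u, v} \<in> edges G" for u v
    using arc_betweenD(1)[OF arc[OF that]] that by (auto simp: A_def)
  moreover have "compact Sbd" "compact Scd"
    using arc_betweenD(1)[OF bd] arc_betweenD(1)[OF cd] by auto
  moreover have "Sbd \<subseteq> (\<Union>e\<in>edges G. path_image (\<gamma> e))" "Scd \<subseteq> (\<Union>e\<in>edges G. path_image (\<gamma> e))"
    unfolding Sbd_def Scd_def using calculation(3) E by auto
  ultimately show False
    using not_inside V E by (simp add: compact_Un)
qed

lemma doubleton_edge_line_graph:
  assumes "e \<in> edges G" "f \<in> edges G" "e \<noteq> f" "x \<in> e" "x \<in> f"
  shows "{e, f} \<in> edges (line_graph G)"
  using assms by (auto simp: line_graph_def)

text \<open>
  Four edges at one vertex are pairwise adjacent in the line graph.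
\<close>

lemma star4_line_graph_not_outerplanar:
  assumes dist: "distinct [x, y1, y2, y3, y4]"
    and E: "{x, y1} \<in> edges G" "{x, y2} \<in> edges G" "{x, y3} \<in> edges G" "{x, y4} \<in> edges G"
  shows "\<not> outerplanar (line_graph G)"
proof (rule K4_not_outerplanar)
  show "{{x, y1}, {x, y2}, {x, y3}, {x, y4}} \<subseteq> vertices (line_graph G)"
    using E by (simp add: line_graph_def)
  show "distinct [{x, y1}, {x, y2}, {x, y3}, {x, y4}]"
    using dist by (simp add: doubleton_eq_iff)
qed (use E dist in \<open>auto intro!: doubleton_edge_line_graph[where x = x] simp: doubleton_eq_iff\<close>)

text \<open>
  The line graph of the complete bipartite graph with parts of sizes two and three is the prism: the
  three edges at each of the two vertices form a triangle.
\<close>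

lemma K23_line_graph_not_outerplanar:
  assumes dist: "distinct [x, x', y1, y2, y3]"
    and E: "{x, y1} \<in> edges G" "{x, y2} \<in> edges G" "{x, y3} \<in> edges G"
      "{x', y1} \<in> edges G" "{x', y2} \<in> edges G" "{x', y3} \<in> edges G"
  shows "\<not> outerplanar (line_graph G)"
proof (rule prism_not_outerplanar)
  show "{{x, y1}, {x, y2}, {x, y3}, {x', y1}, {x', y2}, {x', y3}} \<subseteq> vertices (line_graph G)"
    using E by (simp add: line_graph_def)
  show "distinct [{x, y1}, {x, y2}, {x, y3}, {x', y1}, {x', y2}, {x', y3}]"
    using dist by (simp add: doubleton_eq_iff)
  show "{{x, y1}, {x, y2}} \<in> edges (line_graph G)" "{{x, y1}, {x, y3}} \<in> edges (line_graph G)"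
    "{{x, y2}, {x, y3}} \<in> edges (line_graph G)"
    by (rule doubleton_edge_line_graph[where x = x]; use E dist in \<open>simp add: doubleton_eq_iff\<close>)+
  show "{{x', y1}, {x', y2}} \<in> edges (line_graph G)" "{{x', y1}, {x', y3}} \<in> edges (line_graph G)"
    by (rule doubleton_edge_line_graph[where x = x']; use E dist in \<open>simp add: doubleton_eq_iff\<close>)+
  show "{{x, y1}, {x', y1}} \<in> edges (line_graph G)"
    by (rule doubleton_edge_line_graph[where x = y1]; use E dist in \<open>simp add: doubleton_eq_iff\<close>)
  show "{{x, y2}, {x', y2}} \<in> edges (line_graph G)"
    by (rule doubleton_edge_line_graph[where x = y2]; use E dist in \<open>simp add: doubleton_eq_iff\<close>)
  show "{{x, y3}, {x', y3}} \<in> edges (line_graph G)"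
    by (rule doubleton_edge_line_graph[where x = y3]; use E dist in \<open>simp add: doubleton_eq_iff\<close>)
qed

section \<open>Line graphs that are outerplanar\<close>

text \<open>
  The hexagon \<open>0, 1, 2, 3, 4, 5\<close> together with the inner triangle \<open>1, 3, 5\<close>. Every line graph that has to
  be drawn is a subgraph of this one.
\<close>

definition three_sun :: "nat sgraph" where
  "three_sun = \<lparr> vertices = {0, 1, 2, 3, 4, 5},
     edges = {{0, 1}, {1, 2}, {2, 3}, {3, 4}, {4, 5}, {0, 5}, {1, 3}, {3, 5}, {1, 5}} \<rparr>"

lemma three_sun_outerplanar: "outerplanar three_sun"
proof (rule noncrossing_outerplanar)
  show "e \<subseteq> vertices three_sun \<and> card e = 2" if "e \<in> edges three_sun" for e
    using that unfolding three_sun_def sgraph.simps insert_iff empty_iff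
    by (elim disjE FalseE) simp_all
  show "\<not> (a < c \<and> c < b \<and> b < d)"
    if "{a, b} \<in> edges three_sun" "{c, d} \<in> edges three_sun" for a b c d
    using that unfolding three_sun_def sgraph.simps insert_iff empty_iff doubleton_eq_iff
    by (elim disjE conjE FalseE) simp_all
qed

text \<open>
  The triangle \<open>0, 1, 2\<close> with one pendant vertex at each corner. It is the zero-divisor graph of
  \<open>\<int>\<^sub>2 \<times> \<int>\<^sub>2 \<times> \<int>\<^sub>2\<close>.
\<close>

definition net_graph :: "nat sgraph" where
  "net_graph = \<lparr> vertices = {0, 1, 2, 3, 4, 5},
     edges = {{0, 1}, {1, 2}, {0, 2}, {0, 3}, {1, 4}, {2, 5}} \<rparr>"

definition four_cycle :: "nat sgraph" where
  "four_cycle = \<lparr> vertices = {0, 1, 2, 3}, edges = {{0, 1}, {1, 2}, {2, 3}, {0, 3}} \<rparr>"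

lemma line_graph_net_outerplanar: "outerplanar (line_graph net_graph)"
proof (rule outerplanar_graph_embedding[OF three_sun_outerplanar])
  \<comment> \<open>The edges of the triangle go to the corners \<open>1, 3, 5\<close> of the inner triangle, and each pendant edge
     to the corner of the hexagon between the two triangle edges that it touches.\<close>
  let ?q = "\<lambda>e :: nat set. if e = {0, 3} then 0 else if e = {0, 1} then 1 else
    if e = {1, 4} then 2 else if e = {1, 2} then 3 else if e = {2, 5} then 4 else (5::nat)"
  show "graph_embedding ?q (line_graph net_graph) three_sun"
    unfolding graph_embedding_def
  proof (intro conjI ballI)
    show "edges (line_graph net_graph) \<subseteq> Pow (vertices (line_graph net_graph))"
      by (auto simp: line_graph_def)
    show "inj_on ?q (vertices (line_graph net_graph))"
      by (simp add: line_graph_def net_graph_def doubleton_eq_iff)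
    show "?q ` vertices (line_graph net_graph) \<subseteq> vertices three_sun"
      by (simp add: line_graph_def net_graph_def three_sun_def doubleton_eq_iff)
    fix E assume "E \<in> edges (line_graph net_graph)"
    then obtain e f where ef: "E = {e, f}" "e \<in> edges net_graph" "f \<in> edges net_graph"
        "e \<noteq> f" "e \<inter> f \<noteq> {}"
      by (auto simp: line_graph_def)
    then have "{?q e, ?q f} \<in> edges three_sun"
      unfolding net_graph_def three_sun_def sgraph.simps insert_iff empty_iff
      by (elim disjE FalseE; simp add: doubleton_eq_iff)
    then show "?q ` E \<in> edges three_sun"
      unfolding ef(1) image_insert image_empty .
  qed
qed

lemma line_graph_four_cycle_outerplanar: "outerplanar (line_graph four_cycle)"
proof (rule outerplanar_graph_embedding[OF three_sun_outerplanar])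
  \<comment> \<open>The line graph is again a four-cycle; it is placed on the cycle \<open>0, 1, 3, 5\<close>.\<close>
  let ?q = "\<lambda>e :: nat set. if e = {0, 1} then 0 else if e = {1, 2} then 1 else
    if e = {2, 3} then 3 else (5::nat)"
  show "graph_embedding ?q (line_graph four_cycle) three_sun"
    unfolding graph_embedding_def
  proof (intro conjI ballI)
    show "edges (line_graph four_cycle) \<subseteq> Pow (vertices (line_graph four_cycle))"
      by (auto simp: line_graph_def)
    show "inj_on ?q (vertices (line_graph four_cycle))"
      by (simp add: line_graph_def four_cycle_def doubleton_eq_iff)
    show "?q ` vertices (line_graph four_cycle) \<subseteq> vertices three_sun"
      by (simp add: line_graph_def four_cycle_def three_sun_def doubleton_eq_iff)
    fix E assume "E \<in> edges (line_graph four_cycle)"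
    then obtain e f where ef: "E = {e, f}" "e \<in> edges four_cycle" "f \<in> edges four_cycle"
        "e \<noteq> f" "e \<inter> f \<noteq> {}"
      by (auto simp: line_graph_def)
    then have "{?q e, ?q f} \<in> edges three_sun"
      unfolding four_cycle_def three_sun_def sgraph.simps insert_iff empty_iff
      by (elim disjE FalseE; simp add: doubleton_eq_iff)
    then show "?q ` E \<in> edges three_sun"
      unfolding ef(1) image_insert image_empty .
  qed
qed

section \<open>Idempotents of finite non-local rings\<close>

text \<open>
  The powers of \<open>x\<close> are eventually periodic with some period \<open>k\<close>. For a multiple \<open>n\<close> of \<open>k\<close> beyond the
  preperiod, \<open>x\<^sup>n\<^sup>+\<^sup>n\<close> and \<open>x\<^sup>n\<close> coincide.
\<close>

lemma (in monoid) finite_exists_idempotent_power: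
  assumes "finite (carrier G)" "x \<in> carrier G"
  shows "\<exists>n > 0. x [^] (n::nat) \<otimes> x [^] n = x [^] n"
proof -
  have "\<not> inj (\<lambda>n::nat. x [^] n)"
  proof
    assume "inj (\<lambda>n::nat. x [^] n)"
    moreover have "range (\<lambda>n::nat. x [^] n) \<subseteq> carrier G"
      using assms(2) by auto
    ultimately show False
      using assms(1) finite_imageD finite_subset infinite_UNIV_nat by blast
  qed
  then obtain i j :: nat where ij: "i < j" "x [^] i = x [^] j"
    unfolding inj_def by (metis linorder_neqE_nat)
  define k where "k = j - i"
  have k: "k > 0" "j = i + k"
    using ij(1) by (auto simp: k_def)
  have period: "x [^] (m + i + r * k) = x [^] (m + i)" for m r :: nat
  proof (induction r)
    case (Suc r)
    have "x [^] (m + i + Suc r * k) = x [^] (m + r * k) \<otimes> x [^] j"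
      using assms(2) k(2) by (simp add: nat_pow_mult algebra_simps)
    also have "\<dots> = x [^] (m + i + r * k)"
      using assms(2) ij(2)[symmetric] by (simp add: nat_pow_mult algebra_simps)
    finally show ?case
      using Suc by simp
  qed simp
  define n where "n = Suc i * k"
  have "i \<le> n"
    using k(1) unfolding n_def by (cases k) auto
  then have "x [^] (n - i + i + Suc i * k) = x [^] n"
    using period[of "n - i" "Suc i"] by simp
  then have "x [^] n \<otimes> x [^] n = x [^] n"
    using \<open>i \<le> n\<close> assms(2) by (simp add: nat_pow_mult n_def)
  moreover have "n > 0"
    using k(1) by (simp add: n_def)
  ultimately show ?thesis by blast
qed

lemma (in cring) finite_exists_maximalideal:
  assumes "finite (carrier R)" "\<one> \<noteq> \<zero>"
  shows "\<exists>M. maximalideal M R"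
proof -
  let ?P = "{I. ideal I R \<and> I \<noteq> carrier R}"
  have "?P \<subseteq> Pow (carrier R)"
    using ideal.Icarr by fastforce
  then have "finite ?P"
    using assms(1) finite_subset by blast
  moreover have "{\<zero>} \<in> ?P"
    using zeroideal assms(2) by fastforce
  ultimately obtain M where M: "M \<in> ?P" "\<And>I. I \<in> ?P \<Longrightarrow> M \<subseteq> I \<Longrightarrow> M = I"
    using finite_has_maximal[of ?P] by blast
  have "maximalideal M R"
    by (rule maximalidealI) (use M in blast)+
  then show ?thesis by blast
qed

lemma (in ideal) nat_pow_mem:
  assumes "x \<in> I" "n > 0"
  shows "x [^] (n::nat) \<in> I"
  using assms(2)
proof (induction n)
  case (Suc n)
  then show ?case
    using assms(1) I_l_closed[of x "x [^] n"] Icarr by auto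
qed simp

lemma (in primeideal) nat_pow_mem_imp:
  assumes "x \<in> carrier R" "x [^] (n::nat) \<in> I"
  shows "x \<in> I"
  using assms(2)
proof (induction n)
  case 0
  then show ?case
    using one_imp_carrier assms(1) by auto
next
  case (Suc n)
  then show ?case
    using I_prime[of "x [^] n" x] assms(1) by auto
qed

text \<open>
  Take \<open>x\<close> in one maximal ideal \<open>M\<close> but not in another one, \<open>N\<close>. An idempotent power of \<open>x\<close> is in
  \<open>M\<close>, hence not \<open>\<one>\<close>, and not in the prime ideal \<open>N\<close>, hence not \<open>\<zero>\<close>.
\<close>

lemma (in cring) nonlocal_exists_idempotent:
  assumes fin: "finite (carrier R)" and nontrivial: "\<one> \<noteq> \<zero>" and nonlocal: "\<not> local_ring R"
  shows "\<exists>e\<in>carrier R. e \<otimes> e = e \<and> e \<noteq> \<zero> \<and> e \<noteq> \<one>"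
proof -
  obtain M N where M: "maximalideal M R" and N: "maximalideal N R" and "M \<noteq> N"
    using finite_exists_maximalideal[OF fin nontrivial] nonlocal unfolding local_ring_def by blast
  interpret M: maximalideal M R by (rule M)
  interpret N: maximalideal N R by (rule N)
  interpret N': primeideal N R by (rule maximalideal_prime[OF N])
  have "\<not> M \<subseteq> N"
  proof
    assume "M \<subseteq> N"
    then have "N = M \<or> N = carrier R"
      using M.I_maximal[OF N.is_ideal] N.Icarr by blast
    then show False
      using \<open>M \<noteq> N\<close> N.I_notcarr by simp
  qed
  then obtain x where x: "x \<in> M" "x \<notin> N" by blast
  then have carr: "x \<in> carrier R" using M.Icarr by blast
  obtain n :: nat where n: "n > 0" "x [^] n \<otimes> x [^] n = x [^] n"
    using finite_exists_idempotent_power[OF fin carr] by blast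
  have "x [^] n \<in> M"
    using M.nat_pow_mem[OF x(1) n(1)] .
  then have "x [^] n \<noteq> \<one>"
    using M.one_imp_carrier M.I_notcarr by metis
  moreover have "x [^] n \<notin> N"
    using N'.nat_pow_mem_imp[OF carr] x(2) by blast
  then have "x [^] n \<noteq> \<zero>"
    using additive_subgroup.zero_closed[OF N.is_additive_subgroup] by metis
  ultimately show ?thesis
    using n(2) carr by blast
qed

section \<open>Peirce decomposition\<close>

text \<open>
  For an idempotent \<open>e\<close> this is the Peirce corner \<open>eR\<close>, which has the identity \<open>e\<close>.
\<close>

definition corner_ring :: "('a, 'm) ring_scheme \<Rightarrow> 'a \<Rightarrow> ('a, 'm) ring_scheme" where
  "corner_ring R e = R \<lparr> carrier := (\<lambda>x. e \<otimes>\<^bsub>R\<^esub> x) ` carrier R, one := e \<rparr>"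

lemma corner_ring_simps [simp]:
  "carrier (corner_ring R e) = (\<lambda>x. e \<otimes>\<^bsub>R\<^esub> x) ` carrier R"
  "\<one>\<^bsub>corner_ring R e\<^esub> = e" "\<zero>\<^bsub>corner_ring R e\<^esub> = \<zero>\<^bsub>R\<^esub>"
  "x \<otimes>\<^bsub>corner_ring R e\<^esub> y = x \<otimes>\<^bsub>R\<^esub> y" "x \<oplus>\<^bsub>corner_ring R e\<^esub> y = x \<oplus>\<^bsub>R\<^esub> y"
  by (simp_all add: corner_ring_def)

lemma RDirProd_simps [simp]:
  "carrier (RDirProd R S) = carrier R \<times> carrier S"
  "\<one>\<^bsub>RDirProd R S\<^esub> = (\<one>\<^bsub>R\<^esub>, \<one>\<^bsub>S\<^esub>)" "\<zero>\<^bsub>RDirProd R S\<^esub> = (\<zero>\<^bsub>R\<^esub>, \<zero>\<^bsub>S\<^esub>)"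
  "p \<otimes>\<^bsub>RDirProd R S\<^esub> q = (fst p \<otimes>\<^bsub>R\<^esub> fst q, snd p \<otimes>\<^bsub>S\<^esub> snd q)"
  "p \<oplus>\<^bsub>RDirProd R S\<^esub> q = (fst p \<oplus>\<^bsub>R\<^esub> fst q, snd p \<oplus>\<^bsub>S\<^esub> snd q)"
  by (simp_all add: RDirProd_def DirProd_def monoid.defs case_prod_unfold)

context cring
begin

lemma idempotent_mult_mult:
  assumes "e \<in> carrier R" "e \<otimes> e = e" "x \<in> carrier R" "y \<in> carrier R"
  shows "(e \<otimes> x) \<otimes> (e \<otimes> y) = e \<otimes> (x \<otimes> y)"
proof -
  have "(e \<otimes> x) \<otimes> (e \<otimes> y) = (e \<otimes> e) \<otimes> (x \<otimes> y)"
    using assms(1,3,4) by (simp add: m_ac)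
  then show ?thesis
    using assms(2) by simp
qed

lemma corner_ring_hom:
  assumes "e \<in> carrier R" "e \<otimes> e = e"
  shows "(\<lambda>x. e \<otimes> x) \<in> ring_hom R (corner_ring R e)"
  by (rule ring_hom_memI) (use assms in \<open>auto simp: idempotent_mult_mult r_distr\<close>)

text \<open>
  The corner is the image of \<open>R\<close> under the homomorphism given by multiplication with \<open>e\<close>.
\<close>

lemma corner_ring_cring:
  assumes "e \<in> carrier R" "e \<otimes> e = e"
  shows "cring (corner_ring R e)"
proof -
  have "ring (corner_ring R e \<lparr> carrier := (\<lambda>x. e \<otimes> x) ` carrier R, zero := e \<otimes> \<zero> \<rparr>)"
    by (rule ring_hom_imp_img_ring[OF corner_ring_hom[OF assms]])
  moreover have "corner_ring R e \<lparr> carrier := (\<lambda>x. e \<otimes> x) ` carrier R, zero := e \<otimes> \<zero> \<rparr> =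
      corner_ring R e"
    using assms(1) by (simp add: corner_ring_def)
  ultimately interpret C: ring "corner_ring R e" by simp
  show ?thesis
    by unfold_locales (use assms(1) in \<open>auto simp: m_comm\<close>)
qed

lemma complement_idempotent:
  assumes "e \<in> carrier R" "e \<otimes> e = e"
  shows "(\<one> \<ominus> e) \<otimes> (\<one> \<ominus> e) = \<one> \<ominus> e" "e \<otimes> (\<one> \<ominus> e) = \<zero>" "e \<oplus> (\<one> \<ominus> e) = \<one>"
proof -
  show 0: "e \<otimes> (\<one> \<ominus> e) = \<zero>"
    using assms by (simp add: minus_eq r_distr r_minus r_neg)
  show "e \<oplus> (\<one> \<ominus> e) = \<one>"
    using assms(1) by (simp add: minus_eq a_lcomm[of e \<one>] r_neg)
  have "(\<one> \<ominus> e) \<otimes> (\<one> \<ominus> e) = (\<one> \<ominus> e) \<ominus> e \<otimes> (\<one> \<ominus> e)"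
    using assms(1) by (simp add: minus_eq l_distr l_minus)
  then show "(\<one> \<ominus> e) \<otimes> (\<one> \<ominus> e) = \<one> \<ominus> e"
    using 0 assms(1) by (simp add: minus_eq)
qed

lemma complement_complement:
  "e \<in> carrier R \<Longrightarrow> \<one> \<ominus> (\<one> \<ominus> e) = e"
  by (simp add: minus_eq minus_add r_neg2)

text \<open>
  With \<open>f = \<one> \<ominus> e\<close> each \<open>x\<close> is \<open>ex + fx\<close>, and \<open>ex + fy\<close> has the components \<open>ex\<close> and \<open>fy\<close>
  because \<open>ef = 0\<close>.
\<close>

lemma Peirce_decomposition:
  assumes e: "e \<in> carrier R" "e \<otimes> e = e"
  shows "R \<simeq> RDirProd (corner_ring R e) (corner_ring R (\<one> \<ominus> e))"
proof -
  define f where "f = \<one> \<ominus> e"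
  have f: "f \<in> carrier R" "f \<otimes> f = f" "e \<otimes> f = \<zero>" "e \<oplus> f = \<one>"
    using complement_idempotent[OF e] e(1) by (auto simp: f_def)
  have fe: "f \<otimes> e = \<zero>"
    using f e m_comm by metis
  let ?h = "\<lambda>x. (e \<otimes> x, f \<otimes> x)"
  have "?h \<in> ring_iso R (RDirProd (corner_ring R e) (corner_ring R f))"
  proof (rule ring_iso_memI)
    show "bij_betw ?h (carrier R) (carrier (RDirProd (corner_ring R e) (corner_ring R f)))"
    proof (rule bij_betw_imageI)
      show "inj_on ?h (carrier R)"
      proof (rule inj_onI)
        fix x y assume xy: "x \<in> carrier R" "y \<in> carrier R" "?h x = ?h y"
        have "x = e \<otimes> x \<oplus> f \<otimes> x"
          using xy(1) e f by (metis l_distr l_one)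
        also have "\<dots> = e \<otimes> y \<oplus> f \<otimes> y"
          using xy(3) by simp
        also have "\<dots> = y"
          using xy(2) e f by (metis l_distr l_one)
        finally show "x = y" .
      qed
      have "(e \<otimes> x, f \<otimes> y) \<in> ?h ` carrier R" if "x \<in> carrier R" "y \<in> carrier R" for x y
      proof -
        have z: "e \<otimes> x \<oplus> f \<otimes> y \<in> carrier R"
          using that e f by simp
        have "e \<otimes> (e \<otimes> x \<oplus> f \<otimes> y) = (e \<otimes> e) \<otimes> x \<oplus> (e \<otimes> f) \<otimes> y"
          using that e(1) f(1) by (simp add: r_distr m_assoc)
        then have 1: "e \<otimes> (e \<otimes> x \<oplus> f \<otimes> y) = e \<otimes> x"
          using that e f by simp
        have "f \<otimes> (e \<otimes> x \<oplus> f \<otimes> y) = (f \<otimes> e) \<otimes> x \<oplus> (f \<otimes> f) \<otimes> y"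
          using that e(1) f(1) by (simp add: r_distr m_assoc)
        then have 2: "f \<otimes> (e \<otimes> x \<oplus> f \<otimes> y) = f \<otimes> y"
          using that e(1) f fe by simp
        show ?thesis
          using z 1 2 by (metis (no_types, lifting) image_eqI)
      qed
      then show "?h ` carrier R = carrier (RDirProd (corner_ring R e) (corner_ring R f))"
        by auto
    qed
  qed (use e f in \<open>auto simp: idempotent_mult_mult r_distr\<close>)
  then show ?thesis
    unfolding is_ring_iso_def f_def by blast
qed

end

lemma ring_iso_RDirProd:
  assumes "R \<simeq> R'" "S \<simeq> S'"
  shows "RDirProd R S \<simeq> RDirProd R' S'"
  using assms RDirProd_iso6 unfolding is_ring_iso_def by fastforce

lemma RDirProd_swap: "RDirProd R S \<simeq> RDirProd S R"
  using RDirProd_iso1 unfolding is_ring_iso_def by blast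

section \<open>Rings of small order\<close>

text \<open>
  If \<open>\<one>\<close> generates the additive group, then the multiples of \<open>\<one>\<close> exhaust the ring, and they add and
  multiply like their coefficients modulo the order.
\<close>

lemma (in cring) cyclic_ring_iso_residue_ring:
  assumes fin: "finite (carrier R)" and n: "n = card (carrier R)" "n \<ge> 2"
    and ord: "group.ord (add_monoid R) \<one> = n"
  shows "R \<simeq> residue_ring (int n)"
proof -
  interpret Z: residues "int n" "residue_ring (int n)"
    by unfold_locales (use n(2) in simp_all)
  let ?f = "\<lambda>k::int. add_pow R (nat k) \<one>"
  have carr: "\<one> \<in> carrier (add_monoid R)" by simp
  have mod: "add_pow R (k mod n) \<one> = add_pow R k \<one>" for k :: nat
  proof -
    have "add_pow R k \<one> = add_pow R (n * (k div n)) \<one> \<oplus> add_pow R (k mod n) \<one>"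
      by (metis add.nat_pow_mult mult_div_mod_eq one_closed)
    moreover have "add_pow R (n * (k div n)) \<one> = \<zero>"
      using group.pow_eq_id[OF a_group carr, of "n * (k div n)"] ord by (simp add: add_pow_def)
    ultimately show ?thesis by simp
  qed
  have "?f \<in> ring_iso (residue_ring (int n)) R"
  proof (rule ring_iso_memI)
    fix x y assume "x \<in> carrier (residue_ring (int n))" "y \<in> carrier (residue_ring (int n))"
    then have xy: "0 \<le> x" "0 \<le> y"
      by (auto simp: Z.res_carrier_eq)
    show "?f x \<in> carrier R" by simp
    have "?f (x \<otimes>\<^bsub>residue_ring (int n)\<^esub> y) = add_pow R ((nat x * nat y) mod n) \<one>"
      using xy by (simp add: Z.res_mult_eq nat_mod_distrib nat_mult_distrib)
    also have "\<dots> = ?f x \<otimes> ?f y"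
      unfolding mod by (simp add: add_pow_ldistr add_pow_rdistr add.nat_pow_pow mult.commute)
    finally show "?f (x \<otimes>\<^bsub>residue_ring (int n)\<^esub> y) = ?f x \<otimes> ?f y" .
    have "?f (x \<oplus>\<^bsub>residue_ring (int n)\<^esub> y) = add_pow R ((nat x + nat y) mod n) \<one>"
      using xy by (simp add: Z.res_add_eq nat_mod_distrib nat_add_distrib)
    also have "\<dots> = ?f x \<oplus> ?f y"
      unfolding mod by (simp add: add.nat_pow_mult)
    finally show "?f (x \<oplus>\<^bsub>residue_ring (int n)\<^esub> y) = ?f x \<oplus> ?f y" .
  next
    show "?f \<one>\<^bsub>residue_ring (int n)\<^esub> = \<one>"
      by (simp add: Z.res_one_eq)
    have inj: "inj_on ?f (carrier (residue_ring (int n)))"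
    proof (rule inj_onI)
      fix x y assume xy: "x \<in> carrier (residue_ring (int n))" "y \<in> carrier (residue_ring (int n))"
        "?f x = ?f y"
      have "inj_on (\<lambda>k::nat. add_pow R k \<one>) {0..n - 1}"
        using group.ord_inj[OF a_group carr] ord by (simp add: add_pow_def)
      then have "nat x = nat y"
        using xy by (elim inj_onD) (auto simp: Z.res_carrier_eq)
      then show "x = y"
        using xy by (auto simp: Z.res_carrier_eq)
    qed
    have "?f ` carrier (residue_ring (int n)) \<subseteq> carrier R" by auto
    moreover have "card (?f ` carrier (residue_ring (int n))) = card (carrier R)"
    proof -
      have "card (carrier (residue_ring (int n))) = n"
        by (simp add: Z.res_carrier_eq)
      then show ?thesis
        unfolding card_image[OF inj] n(1)[symmetric] .
    qed
    ultimately have "?f ` carrier (residue_ring (int n)) = carrier R"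
      by (rule card_subset_eq[OF fin])
    then show "bij_betw ?f (carrier (residue_ring (int n))) (carrier R)"
      using inj by (rule bij_betw_imageI[rotated])
  qed
  then have "residue_ring (int n) \<simeq> R"
    unfolding is_ring_iso_def by blast
  then show ?thesis
    by (rule ring_iso_sym[OF cring.axioms(1)[OF Z.cring]])
qed

lemma (in cring) prime_card_ring_iso_residue_ring:
  assumes "Factorial_Ring.prime (card (carrier R))"
  shows "R \<simeq> residue_ring (int (card (carrier R)))"
proof (rule cyclic_ring_iso_residue_ring)
  show fin: "finite (carrier R)"
    by (rule ccontr) (use assms in simp)
  show ge: "card (carrier R) \<ge> 2"
    by (rule prime_ge_2_nat[OF assms])
  have "\<one> \<noteq> \<zero>"
  proof
    assume "\<one> = \<zero>"
    then have "carrier R = {\<zero>}"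
      by (rule one_zeroD)
    then show False
      using ge by simp
  qed
  then have "group.ord (add_monoid R) \<one> \<noteq> 1"
    using group.ord_eq_1[OF a_group, of \<one>] by simp
  moreover have "group.ord (add_monoid R) \<one> dvd card (carrier R)"
    using group.ord_dvd_group_order[OF a_group, of \<one>] by (simp add: order_def)
  ultimately show "group.ord (add_monoid R) \<one> = card (carrier R)"
    using assms unfolding prime_nat_iff by blast
qed simp

context cring
begin

lemma char_two_add_self:
  assumes "\<one> \<oplus> \<one> = \<zero>" "x \<in> carrier R"
  shows "x \<oplus> x = \<zero>"
proof -
  have "x \<oplus> x = x \<otimes> (\<one> \<oplus> \<one>)"
    using assms(2) by (simp add: r_distr)
  then show ?thesis
    using assms by simp
qed

lemma char_two_add_cancel:
  assumes "\<one> \<oplus> \<one> = \<zero>" "x \<in> carrier R" "y \<in> carrier R"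
  shows "x \<oplus> (x \<oplus> y) = y"
  using assms by (metis a_assoc char_two_add_self l_zero)

lemma char_two_distinct:
  assumes "\<one> \<oplus> \<one> = \<zero>" "s \<in> carrier R" "s \<noteq> \<zero>" "s \<noteq> \<one>"
  shows "distinct [\<zero>, \<one>, s, \<one> \<oplus> s]"
proof -
  have "\<one> \<oplus> s \<noteq> \<zero>"
    using assms by (metis char_two_add_cancel one_closed r_zero)
  moreover have one_nonzero: "\<one> \<noteq> \<zero>"
    using assms(2,3) one_zeroD by blast
  moreover have "\<one> \<oplus> s \<noteq> \<one>" "\<one> \<oplus> s \<noteq> s"
    using assms(2,3) one_nonzero by simp_all
  ultimately show ?thesis
    using assms(3,4) by auto
qed

lemma char_two_four_elements:
  assumes "\<one> \<oplus> \<one> = \<zero>" "card (carrier R) = 4" "s \<in> carrier R" "s \<noteq> \<zero>" "s \<noteq> \<one>"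
  shows "carrier R = {\<zero>, \<one>, s, \<one> \<oplus> s}"
proof -
  have "card {\<zero>, \<one>, s, \<one> \<oplus> s} = 4"
    using distinct_card[OF char_two_distinct[OF assms(1,3-5)]] by simp
  moreover have "{\<zero>, \<one>, s, \<one> \<oplus> s} \<subseteq> carrier R"
    using assms(3) by auto
  moreover have "finite (carrier R)"
    by (rule ccontr) (use assms(2) in simp)
  ultimately show ?thesis
    using assms(2) card_subset_eq by metis
qed

lemma dual_number_distinct:
  assumes "\<one> \<oplus> \<one> = \<zero>" "s \<in> carrier R" "s \<noteq> \<zero>" "s \<otimes> s = \<zero>"
  shows "distinct [\<zero>, \<one>, s, \<one> \<oplus> s]"
proof (rule char_two_distinct)
  show "s \<noteq> \<one>"
    using assms(3,4) by auto
qed (use assms in auto)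

text \<open>
  As the four elements exhaust the ring of dual numbers, any identity in it can be checked by
  rewriting with these tables.
\<close>

lemma dual_number_tables:
  assumes "\<one> \<oplus> \<one> = \<zero>" "s \<in> carrier R" "s \<otimes> s = \<zero>"
  shows "s \<oplus> \<one> = \<one> \<oplus> s" "s \<oplus> s = \<zero>" "\<one> \<oplus> (\<one> \<oplus> s) = s" "(\<one> \<oplus> s) \<oplus> \<one> = s"
    "s \<oplus> (\<one> \<oplus> s) = \<one>" "(\<one> \<oplus> s) \<oplus> s = \<one>" "(\<one> \<oplus> s) \<oplus> (\<one> \<oplus> s) = \<zero>"
    "s \<otimes> (\<one> \<oplus> s) = s" "(\<one> \<oplus> s) \<otimes> s = s" "(\<one> \<oplus> s) \<otimes> (\<one> \<oplus> s) = \<one>"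
proof -
  note cancel = char_two_add_cancel[OF assms(1)]
  show comm: "s \<oplus> \<one> = \<one> \<oplus> s"
    using assms(2) by (simp add: a_comm)
  show self: "s \<oplus> s = \<zero>" "(\<one> \<oplus> s) \<oplus> (\<one> \<oplus> s) = \<zero>"
    using char_two_add_self[OF assms(1)] assms(2) by simp_all
  show 1: "\<one> \<oplus> (\<one> \<oplus> s) = s"
    using cancel assms(2) by simp
  show "(\<one> \<oplus> s) \<oplus> \<one> = s"
    using 1 assms(2) by (metis a_closed a_comm one_closed)
  show 2: "s \<oplus> (\<one> \<oplus> s) = \<one>"
    using cancel[of s \<one>] comm assms(2) by simp
  show "(\<one> \<oplus> s) \<oplus> s = \<one>"
    using 2 assms(2) by (metis a_closed a_comm one_closed)
  show 3: "s \<otimes> (\<one> \<oplus> s) = s"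
    using assms(2,3) by (simp add: r_distr)
  show 4: "(\<one> \<oplus> s) \<otimes> s = s"
    using 3 assms(2) by (simp add: m_comm)
  show "(\<one> \<oplus> s) \<otimes> (\<one> \<oplus> s) = \<one>"
    using assms(2) 4 1 \<open>(\<one> \<oplus> s) \<oplus> s = \<one>\<close> by (simp add: r_distr)
qed

end

text \<open>
  In both rings the operations on the four elements \<open>0, 1, s, 1 + s\<close> are forced, so matching \<open>s\<close>
  with \<open>t\<close> is an isomorphism. It allows \<open>\<int>\<^sub>2[x]/(x\<^sup>2)\<close> to be recognised without constructing a
  homomorphism out of the quotient.
\<close>

lemma dual_numbers_unique:
  assumes R: "cring R" "card (carrier R) = 4" "\<one>\<^bsub>R\<^esub> \<oplus>\<^bsub>R\<^esub> \<one>\<^bsub>R\<^esub> = \<zero>\<^bsub>R\<^esub>"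
      "s \<in> carrier R" "s \<noteq> \<zero>\<^bsub>R\<^esub>" "s \<otimes>\<^bsub>R\<^esub> s = \<zero>\<^bsub>R\<^esub>"
    and S: "cring S" "card (carrier S) = 4" "\<one>\<^bsub>S\<^esub> \<oplus>\<^bsub>S\<^esub> \<one>\<^bsub>S\<^esub> = \<zero>\<^bsub>S\<^esub>"
      "t \<in> carrier S" "t \<noteq> \<zero>\<^bsub>S\<^esub>" "t \<otimes>\<^bsub>S\<^esub> t = \<zero>\<^bsub>S\<^esub>"
  shows "R \<simeq> S"
proof -
  interpret R: cring R by (rule R(1))
  interpret S: cring S by (rule S(1))
  note Rd = R.dual_number_distinct[OF R(3-6)] and Sd = S.dual_number_distinct[OF S(3-6)]
  have "s \<noteq> \<one>\<^bsub>R\<^esub>" "t \<noteq> \<one>\<^bsub>S\<^esub>"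
    using Rd Sd by auto
  note Rc = R.char_two_four_elements[OF R(3,2,4,5) this(1)]
    and Sc = S.char_two_four_elements[OF S(3,2,4,5) this(2)]
  define f where "f x = (if x = \<zero>\<^bsub>R\<^esub> then \<zero>\<^bsub>S\<^esub> else if x = \<one>\<^bsub>R\<^esub> then \<one>\<^bsub>S\<^esub> else
    if x = s then t else \<one>\<^bsub>S\<^esub> \<oplus>\<^bsub>S\<^esub> t)" for x
  have f: "f \<zero>\<^bsub>R\<^esub> = \<zero>\<^bsub>S\<^esub>" "f \<one>\<^bsub>R\<^esub> = \<one>\<^bsub>S\<^esub>" "f s = t" "f (\<one>\<^bsub>R\<^esub> \<oplus>\<^bsub>R\<^esub> s) = \<one>\<^bsub>S\<^esub> \<oplus>\<^bsub>S\<^esub> t"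
    using Rd by (auto simp: f_def)
  note tables = R.dual_number_tables[OF R(3,4,6)] S.dual_number_tables[OF S(3,4,6)] R(3,6) S(3,6)
  have "f \<in> ring_iso R S"
  proof (rule ring_iso_memI)
    fix x y assume "x \<in> carrier R" "y \<in> carrier R"
    then have x: "x = \<zero>\<^bsub>R\<^esub> \<or> x = \<one>\<^bsub>R\<^esub> \<or> x = s \<or> x = \<one>\<^bsub>R\<^esub> \<oplus>\<^bsub>R\<^esub> s"
      and y: "y = \<zero>\<^bsub>R\<^esub> \<or> y = \<one>\<^bsub>R\<^esub> \<or> y = s \<or> y = \<one>\<^bsub>R\<^esub> \<oplus>\<^bsub>R\<^esub> s"
      unfolding Rc by auto
    show "f x \<in> carrier S"
      using x S(4) by (elim disjE) (simp_all add: f)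
    show "f (x \<otimes>\<^bsub>R\<^esub> y) = f x \<otimes>\<^bsub>S\<^esub> f y"
      using x y by (elim disjE) (simp_all add: f tables R(4) S(4))
    show "f (x \<oplus>\<^bsub>R\<^esub> y) = f x \<oplus>\<^bsub>S\<^esub> f y"
      using x y by (elim disjE) (simp_all add: f tables R(4) S(4))
  next
    have surj: "f ` carrier R = carrier S"
      unfolding Rc Sc image_insert image_empty f ..
    have "finite (carrier R)"
      unfolding Rc by simp
    then have "inj_on f (carrier R)"
      by (rule eq_card_imp_inj_on) (simp add: surj R(2) S(2))
    then show "bij_betw f (carrier R) (carrier S)"
      using surj by (rule bij_betw_imageI)
  qed (rule f)
  then show ?thesis
    unfolding is_ring_iso_def by blast
qed

text \<open>
  Two divisions by \<open>x\<close> with remainder show that each polynomial is congruent modulo \<open>x\<^sup>2\<close> to one of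
  \<open>0, 1, x, 1 + x\<close>. These are distinct in the quotient as soon as \<open>x\<close> is not in the ideal generated by
  \<open>x\<^sup>2\<close>; if it were, cancelling \<open>x\<close> would make \<open>x\<close> a unit.
\<close>

lemma Z2_dual_numbers_structure:
  shows "cring Z2_dual_numbers" "card (carrier Z2_dual_numbers) = 4"
    "\<one>\<^bsub>Z2_dual_numbers\<^esub> \<oplus>\<^bsub>Z2_dual_numbers\<^esub> \<one>\<^bsub>Z2_dual_numbers\<^esub> = \<zero>\<^bsub>Z2_dual_numbers\<^esub>"
    "\<exists>s\<in>carrier Z2_dual_numbers. s \<noteq> \<zero>\<^bsub>Z2_dual_numbers\<^esub> \<and>
       s \<otimes>\<^bsub>Z2_dual_numbers\<^esub> s = \<zero>\<^bsub>Z2_dual_numbers\<^esub>"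
proof -
  define K where "K = residue_ring 2"
  define P where "P = poly_ring K"
  define x where "x = X\<^bsub>K\<^esub>"
  define I where "I = Idl\<^bsub>P\<^esub> {x [^]\<^bsub>P\<^esub> (2::nat)}"
  define D where "D = P Quot I"
  have D_eq: "Z2_dual_numbers = D"
    unfolding D_def I_def x_def P_def K_def ..
  interpret K: field K
    using residues_prime.is_field[of 2] by (simp add: residues_prime_def K_def)
  interpret P: domain P
    unfolding P_def by (rule K.univ_poly_is_domain[OF K.carrier_is_subring])
  have K_elems: "carrier K = {0, 1}" "\<zero>\<^bsub>K\<^esub> = 0" "\<one>\<^bsub>K\<^esub> = 1"
    by (auto simp: K_def residue_ring_def)
  have P_zero: "\<zero>\<^bsub>P\<^esub> = []" and P_one: "\<one>\<^bsub>P\<^esub> = [1]"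
    by (simp_all add: P_def univ_poly_zero univ_poly_one K_elems)
  have x: "x \<in> carrier P"
    unfolding x_def P_def by (rule K.var_closed(1)[OF K.carrier_is_subring])
  have x_eq: "x = [1, 0]"
    by (simp add: x_def var_def K_elems)
  have x2: "x [^]\<^bsub>P\<^esub> (2::nat) = x \<otimes>\<^bsub>P\<^esub> x"
    using x by (simp add: numeral_2_eq_2)
  have ideal: "ideal I P"
    unfolding I_def by (rule P.genideal_ideal) (use x in simp)
  interpret I: ideal I P by (rule ideal)
  have x2_mem: "x \<otimes>\<^bsub>P\<^esub> x \<in> I"
    using P.genideal_self'[of "x [^]\<^bsub>P\<^esub> (2::nat)"] x unfolding I_def x2 by simp
  have "x \<notin> I"
  proof
    assume "x \<in> I"
    moreover have "I = PIdl\<^bsub>P\<^esub> (x \<otimes>\<^bsub>P\<^esub> x)"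
      using P.cgenideal_eq_genideal[of "x \<otimes>\<^bsub>P\<^esub> x"] x unfolding I_def x2 by simp
    ultimately obtain q where q: "q \<in> carrier P" "x = q \<otimes>\<^bsub>P\<^esub> (x \<otimes>\<^bsub>P\<^esub> x)"
      unfolding cgenideal_def by blast
    have "x \<otimes>\<^bsub>P\<^esub> (x \<otimes>\<^bsub>P\<^esub> q) = q \<otimes>\<^bsub>P\<^esub> (x \<otimes>\<^bsub>P\<^esub> x)"
      using q(1) x by (simp add: P.m_ac)
    then have "x \<otimes>\<^bsub>P\<^esub> (x \<otimes>\<^bsub>P\<^esub> q) = x \<otimes>\<^bsub>P\<^esub> \<one>\<^bsub>P\<^esub>"
      using q(2) x by simp
    moreover have "x \<noteq> \<zero>\<^bsub>P\<^esub>"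
      by (simp add: x_eq P_zero)
    ultimately have "x \<otimes>\<^bsub>P\<^esub> q = \<one>\<^bsub>P\<^esub>"
      using P.m_lcancel[of x "x \<otimes>\<^bsub>P\<^esub> q" "\<one>\<^bsub>P\<^esub>"] x q(1) by simp
    then have "x \<in> Units P"
      using x q(1) P.m_comm by (auto simp: Units_def)
    then show False
      unfolding P_def K.univ_poly_units[OF K.carrier_is_subfield] by (auto simp: x_eq)
  qed
  have cring: "cring D"
    unfolding D_def by (rule I.quotient_is_cring[OF P.cring_axioms])
  interpret D: cring D by (rule cring)
  let ?\<phi> = "\<lambda>p. I +>\<^bsub>P\<^esub> p"
  have hom: "?\<phi> \<in> ring_hom P D"
    unfolding D_def by (rule I.rcos_ring_hom)
  note \<phi> = ring_hom_memE[OF hom]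
  have D_zero: "\<zero>\<^bsub>D\<^esub> = I"
    by (simp add: D_def FactRing_def)
  have \<phi>_zero: "?\<phi> p = \<zero>\<^bsub>D\<^esub> \<longleftrightarrow> p \<in> I" if "p \<in> carrier P" for p
    using that P.a_rcos_zero[OF ideal] I.rcos_const_imp_mem by (auto simp: D_zero)
  define s where "s = ?\<phi> x"
  have s: "s \<in> carrier D" "s \<noteq> \<zero>\<^bsub>D\<^esub>" "s \<otimes>\<^bsub>D\<^esub> s = \<zero>\<^bsub>D\<^esub>"
    using \<phi>(1)[OF x] \<phi>_zero[OF x] \<open>x \<notin> I\<close> \<phi>(2)[OF x x] \<phi>_zero[of "x \<otimes>\<^bsub>P\<^esub> x"] x2_mem x
    by (auto simp: s_def)
  have "\<one>\<^bsub>P\<^esub> \<oplus>\<^bsub>P\<^esub> \<one>\<^bsub>P\<^esub> = \<zero>\<^bsub>P\<^esub>"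
    unfolding P_zero P_one
    by (simp add: P_def univ_poly_add K.poly_add.simps K_elems) (simp add: K_def residue_ring_def)
  then have two: "\<one>\<^bsub>D\<^esub> \<oplus>\<^bsub>D\<^esub> \<one>\<^bsub>D\<^esub> = \<zero>\<^bsub>D\<^esub>"
    using \<phi>(3)[OF P.one_closed P.one_closed] \<phi>(4) \<phi>_zero[OF P.zero_closed] I.zero_closed by simp
  have div_x: "\<exists>q\<in>carrier P. \<exists>r\<in>{\<zero>\<^bsub>P\<^esub>, \<one>\<^bsub>P\<^esub>}. p = (x \<otimes>\<^bsub>P\<^esub> q) \<oplus>\<^bsub>P\<^esub> r"
    if p: "p \<in> carrier P" for p
  proof -
    obtain q r where qr: "q \<in> carrier P" "r \<in> carrier P" "p = (x \<otimes>\<^bsub>P\<^esub> q) \<oplus>\<^bsub>P\<^esub> r"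
      "r = \<zero>\<^bsub>P\<^esub> \<or> length r - 1 < length x - 1"
      using K.field_long_division_theorem_shell[OF K.carrier_is_subfield, of p x] p x
      unfolding P_def[symmetric] by (auto simp: P_zero x_eq)
    have "r \<in> {\<zero>\<^bsub>P\<^esub>, \<one>\<^bsub>P\<^esub>}"
    proof (cases r)
      case (Cons a l)
      then have "r = [a]"
        using qr(4) by (auto simp: P_zero x_eq)
      moreover have "a \<in> carrier K" "a \<noteq> \<zero>\<^bsub>K\<^esub>"
        using qr(2) unfolding P_def univ_poly_carrier[symmetric] polynomial_def \<open>r = [a]\<close> by auto
      ultimately show ?thesis
        by (auto simp: P_one K_elems)
    qed (simp add: P_zero)
    then show ?thesis
      using qr by blast
  qed
  have carrier_D: "carrier D = {\<zero>\<^bsub>D\<^esub>, \<one>\<^bsub>D\<^esub>, s, \<one>\<^bsub>D\<^esub> \<oplus>\<^bsub>D\<^esub> s}"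
  proof
    show "{\<zero>\<^bsub>D\<^esub>, \<one>\<^bsub>D\<^esub>, s, \<one>\<^bsub>D\<^esub> \<oplus>\<^bsub>D\<^esub> s} \<subseteq> carrier D"
      using s(1) by auto
    show "carrier D \<subseteq> {\<zero>\<^bsub>D\<^esub>, \<one>\<^bsub>D\<^esub>, s, \<one>\<^bsub>D\<^esub> \<oplus>\<^bsub>D\<^esub> s}"
    proof
      fix y assume "y \<in> carrier D"
      then obtain p where p: "p \<in> carrier P" "y = ?\<phi> p"
        by (auto simp: D_def FactRing_def A_RCOSETS_def')
      obtain q r where q: "q \<in> carrier P" "r \<in> {\<zero>\<^bsub>P\<^esub>, \<one>\<^bsub>P\<^esub>}" "p = (x \<otimes>\<^bsub>P\<^esub> q) \<oplus>\<^bsub>P\<^esub> r"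
        using div_x[OF p(1)] by blast
      obtain q' r' where q': "q' \<in> carrier P" "r' \<in> {\<zero>\<^bsub>P\<^esub>, \<one>\<^bsub>P\<^esub>}" "q = (x \<otimes>\<^bsub>P\<^esub> q') \<oplus>\<^bsub>P\<^esub> r'"
        using div_x[OF q(1)] by blast
      have r: "r \<in> carrier P" "r' \<in> carrier P" "?\<phi> r \<in> {\<zero>\<^bsub>D\<^esub>, \<one>\<^bsub>D\<^esub>}" "?\<phi> r' \<in> {\<zero>\<^bsub>D\<^esub>, \<one>\<^bsub>D\<^esub>}"
        using q(2) q'(2) \<phi>(4) \<phi>_zero[of "\<zero>\<^bsub>P\<^esub>"] I.zero_closed by auto
      have "y = s \<otimes>\<^bsub>D\<^esub> (s \<otimes>\<^bsub>D\<^esub> ?\<phi> q' \<oplus>\<^bsub>D\<^esub> ?\<phi> r') \<oplus>\<^bsub>D\<^esub> ?\<phi> r"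
        unfolding p(2) q(3) q'(3) s_def using x q' r(1,2) by (simp add: \<phi>(2,3))
      also have "s \<otimes>\<^bsub>D\<^esub> (s \<otimes>\<^bsub>D\<^esub> ?\<phi> q' \<oplus>\<^bsub>D\<^esub> ?\<phi> r') = (s \<otimes>\<^bsub>D\<^esub> s) \<otimes>\<^bsub>D\<^esub> ?\<phi> q' \<oplus>\<^bsub>D\<^esub> s \<otimes>\<^bsub>D\<^esub> ?\<phi> r'"
        using s(1) \<phi>(1)[OF q'(1)] \<phi>(1)[OF r(2)] by (simp add: D.r_distr D.m_assoc)
      finally have "y = s \<otimes>\<^bsub>D\<^esub> ?\<phi> r' \<oplus>\<^bsub>D\<^esub> ?\<phi> r"
        using s \<phi>(1)[OF q'(1)] \<phi>(1)[OF r(2)] by simp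
      then show "y \<in> {\<zero>\<^bsub>D\<^esub>, \<one>\<^bsub>D\<^esub>, s, \<one>\<^bsub>D\<^esub> \<oplus>\<^bsub>D\<^esub> s}"
        using r(3,4) s(1) by (auto simp: D.a_comm)
    qed
  qed
  have "card (carrier D) = 4"
    unfolding carrier_D using distinct_card[OF D.dual_number_distinct[OF two s]] by simp
  then show "cring Z2_dual_numbers" "card (carrier Z2_dual_numbers) = 4"
    "\<one>\<^bsub>Z2_dual_numbers\<^esub> \<oplus>\<^bsub>Z2_dual_numbers\<^esub> \<one>\<^bsub>Z2_dual_numbers\<^esub> = \<zero>\<^bsub>Z2_dual_numbers\<^esub>"
    "\<exists>s\<in>carrier Z2_dual_numbers. s \<noteq> \<zero>\<^bsub>Z2_dual_numbers\<^esub> \<and>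
       s \<otimes>\<^bsub>Z2_dual_numbers\<^esub> s = \<zero>\<^bsub>Z2_dual_numbers\<^esub>"
    unfolding D_eq using cring two s by auto
qed

context cring
begin

lemma two_le_card_corner:
  assumes "finite (carrier R)" "e \<in> carrier R" "e \<otimes> e = e" "e \<noteq> \<zero>"
  shows "2 \<le> card (carrier (corner_ring R e))"
proof -
  have "e \<otimes> e \<in> carrier (corner_ring R e)" "e \<otimes> \<zero> \<in> carrier (corner_ring R e)"
    unfolding corner_ring_simps by (rule imageI, use assms(2) in simp)+
  then have "{\<zero>, e} \<subseteq> carrier (corner_ring R e)"
    using assms(2,3) by simp
  then have "card {\<zero>, e} \<le> card (carrier (corner_ring R e))"
    using assms(1) by (intro card_mono) simp_all
  then show ?thesis
    using assms(4) by (simp add: eq_commute)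
qed

lemma complement_nonzero:
  assumes "e \<in> carrier R" "e \<noteq> \<one>"
  shows "\<one> \<ominus> e \<noteq> \<zero>"
  using assms by simp

text \<open>
  Both corners have at least two elements and their cardinalities multiply to four.
\<close>

lemma card4_idempotent:
  assumes card: "card (carrier R) = 4" and e: "e \<in> carrier R" "e \<otimes> e = e" "e \<noteq> \<zero>" "e \<noteq> \<one>"
  shows "R \<simeq> RDirProd (residue_ring 2) (residue_ring 2)"
proof -
  define f where "f = \<one> \<ominus> e"
  have f: "f \<in> carrier R" "f \<otimes> f = f" "f \<noteq> \<zero>"
    using complement_idempotent(1)[OF e(1,2)] complement_nonzero[OF e(1,4)] e(1) by (simp_all add: f_def)
  have fin: "finite (carrier R)"
    by (rule ccontr) (use card in simp)
  have iso: "R \<simeq> RDirProd (corner_ring R e) (corner_ring R f)"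
    unfolding f_def by (rule Peirce_decomposition[OF e(1,2)])
  define m n where "m = card (carrier (corner_ring R e))" and "n = card (carrier (corner_ring R f))"
  have "m * n = 4"
    using ring_iso_same_card[OF iso] card unfolding RDirProd_simps(1) card_cartesian_product m_def n_def
    by simp
  moreover have ge: "2 \<le> m" "2 \<le> n"
    unfolding m_def n_def using two_le_card_corner fin e f by blast+
  ultimately have "2 * n \<le> 4" "m * 2 \<le> 4"
    by (metis mult_le_mono1, metis mult_le_mono2)
  then have "m = 2" "n = 2"
    using ge by simp_all
  then have two: "card (carrier (corner_ring R e)) = 2" "card (carrier (corner_ring R f)) = 2"
    by (simp_all only: m_def n_def)
  have "corner_ring R e \<simeq> residue_ring 2"
    using cring.prime_card_ring_iso_residue_ring[OF corner_ring_cring[OF e(1,2)]] two(1) by simp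
  moreover have "corner_ring R f \<simeq> residue_ring 2"
    using cring.prime_card_ring_iso_residue_ring[OF corner_ring_cring[OF f(1,2)]] two(2) by simp
  ultimately show ?thesis
    using ring_iso_trans[OF iso ring_iso_RDirProd] by blast
qed

text \<open>
  The additive order of \<open>\<one>\<close> is four, and the ring is \<open>\<int>\<^sub>4\<close>, or it is two. In the latter case the ring
  consists of \<open>0, 1, s, 1 + s\<close>, and the four possible values of \<open>s\<^sup>2\<close> give, in turn, the dual numbers,
  the dual numbers with \<open>1 + s\<close> in the role of \<open>s\<close>, a nontrivial idempotent, and a field, as then
  \<open>s (1 + s) = 1\<close>.
\<close>

lemma card4_classification:
  assumes card: "card (carrier R) = 4"
  shows "field R \<or> R \<simeq> residue_ring 4 \<or> R \<simeq> Z2_dual_numbers \<or>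
    R \<simeq> RDirProd (residue_ring 2) (residue_ring 2)"
proof -
  define n where "n = group.ord (add_monoid R) \<one>"
  have fin: "finite (carrier R)"
    by (rule ccontr) (use card in simp)
  have one_nonzero: "\<one> \<noteq> \<zero>"
  proof
    assume "\<one> = \<zero>"
    then have "carrier R = {\<zero>}"
      by (rule one_zeroD)
    then show False
      using card by simp
  qed
  have dvd: "n dvd 4"
    using group.ord_dvd_group_order[OF a_group, of \<one>] card by (simp add: order_def n_def)
  then have "n \<le> 4"
    by (rule dvd_imp_le) simp
  then have "n = 0 \<or> n = 1 \<or> n = 2 \<or> n = 3 \<or> n = 4"
    by linarith
  moreover have "n \<noteq> 1"
    using group.ord_eq_1[OF a_group, of \<one>] one_nonzero by (simp add: n_def)
  ultimately consider "n = 4" | "n = 2"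
    using dvd by auto
  then show ?thesis
  proof cases
    case 1
    then have "R \<simeq> residue_ring (int 4)"
      using cyclic_ring_iso_residue_ring[OF fin, of 4] card by (simp add: n_def)
    then show ?thesis by simp
  next
    case 2
    have "\<one> [^]\<^bsub>add_monoid R\<^esub> n = \<zero>"
      using group.pow_ord_eq_1[OF a_group, of \<one>] by (simp add: n_def)
    then have two: "\<one> \<oplus> \<one> = \<zero>"
      using 2 by (simp add: numeral_2_eq_2 nat_pow_def)
    have "\<exists>s\<in>carrier R. s \<noteq> \<zero> \<and> s \<noteq> \<one>"
    proof (rule ccontr)
      assume "\<not> ?thesis"
      then have "carrier R \<subseteq> {\<zero>, \<one>}" by blast
      then have "card (carrier R) \<le> card {\<zero>, \<one>}"
        by (rule card_mono[rotated]) simp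
      also have "\<dots> \<le> 2"
        by (simp add: card_insert_if)
      finally show False
        using card by simp
    qed
    then obtain s where s: "s \<in> carrier R" "s \<noteq> \<zero>" "s \<noteq> \<one>" by blast
    have elems: "carrier R = {\<zero>, \<one>, s, \<one> \<oplus> s}"
      by (rule char_two_four_elements[OF two card s])
    have dist: "distinct [\<zero>, \<one>, s, \<one> \<oplus> s]"
      by (rule char_two_distinct[OF two s])
    have dual: "R \<simeq> Z2_dual_numbers" if t: "t \<in> carrier R" "t \<noteq> \<zero>" "t \<otimes> t = \<zero>" for t
    proof -
      obtain d where "d \<in> carrier Z2_dual_numbers" "d \<noteq> \<zero>\<^bsub>Z2_dual_numbers\<^esub>"
        "d \<otimes>\<^bsub>Z2_dual_numbers\<^esub> d = \<zero>\<^bsub>Z2_dual_numbers\<^esub>"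
        using Z2_dual_numbers_structure(4) by blast
      then show ?thesis
        using dual_numbers_unique[OF cring_axioms card two t Z2_dual_numbers_structure(1-3)] by blast
    qed
    have "s \<otimes> s \<in> carrier R" using s by simp
    then consider "s \<otimes> s = \<zero>" | "s \<otimes> s = \<one>" | "s \<otimes> s = s" | "s \<otimes> s = \<one> \<oplus> s"
      unfolding elems by auto
    then show ?thesis
    proof cases
      case 1
      then show ?thesis using dual s by blast
    next
      case 2
      have "(\<one> \<oplus> s) \<otimes> (\<one> \<oplus> s) = (\<one> \<oplus> s) \<oplus> (s \<oplus> s \<otimes> s)"
        using s(1) by (simp add: l_distr r_distr)
      also have "\<dots> = (\<one> \<oplus> s) \<oplus> (\<one> \<oplus> s)"
        using 2 s(1) by (simp add: a_comm)
      also have "\<dots> = \<zero>"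
        using char_two_add_self[OF two] s(1) by simp
      finally show ?thesis
        using dual[of "\<one> \<oplus> s"] dist s(1) by auto
    next
      case 3
      then show ?thesis
        using card4_idempotent[OF card s(1)] s by blast
    next
      case 4
      have inverse: "s \<otimes> (\<one> \<oplus> s) = \<one>" "(\<one> \<oplus> s) \<otimes> s = \<one>"
      proof -
        have "s \<otimes> (\<one> \<oplus> s) = s \<oplus> (s \<oplus> \<one>)"
          using 4 s(1) by (simp add: r_distr a_comm)
        then show "s \<otimes> (\<one> \<oplus> s) = \<one>"
          using char_two_add_cancel[OF two] s(1) by simp
        then show "(\<one> \<oplus> s) \<otimes> s = \<one>"
          using s(1) by (simp add: m_comm)
      qed
      then have "{s, \<one> \<oplus> s} \<subseteq> Units R"
        using s(1) by (auto simp: Units_def)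
      then have "carrier R - {\<zero>} \<subseteq> Units R"
        unfolding elems by auto
      moreover have "\<zero> \<notin> Units R"
        using one_nonzero by (auto simp: Units_def)
      ultimately have "Units R = carrier R - {\<zero>}"
        by (auto simp: Units_def)
      then have "field R"
        by (rule cring_fieldI)
      then show ?thesis by blast
    qed
  qed
qed

end

section \<open>Zero-divisor graphs of rings with an idempotent\<close>

context cring
begin

text \<open>
  Elements of complementary corners annihilate each other, so the zero-divisor graph contains the
  complete bipartite graph between the nonzero elements of the two corners.
\<close>

lemma corner_edge:
  assumes e: "e \<in> carrier R" "e \<otimes> e = e"
    and x: "x \<in> carrier (corner_ring R e) - {\<zero>}"
    and y: "y \<in> carrier (corner_ring R (\<one> \<ominus> e)) - {\<zero>}"
  shows "{x, y} \<in> edges (zero_divisor_graph R)" "x \<noteq> y"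
proof -
  define f where "f = \<one> \<ominus> e"
  have f: "f \<in> carrier R" "e \<otimes> f = \<zero>"
    using complement_idempotent(2)[OF e] e(1) by (simp_all add: f_def)
  obtain a b where ab: "a \<in> carrier R" "x = e \<otimes> a" "b \<in> carrier R" "y = f \<otimes> b"
    using x y by (auto simp: f_def)
  have carr: "x \<in> carrier R" "y \<in> carrier R" "x \<noteq> \<zero>" "y \<noteq> \<zero>"
    using ab e(1) f(1) x y by auto
  have "x \<otimes> y = (e \<otimes> f) \<otimes> (a \<otimes> b)"
    unfolding ab(2,4) using ab(1,3) e(1) f(1) by (simp add: m_ac)
  then have prod: "x \<otimes> y = \<zero>" "y \<otimes> x = \<zero>"
    using f(2) ab carr by (simp_all add: m_comm)
  show "x \<noteq> y"
  proof
    assume "x = y"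
    have "e \<otimes> x = x"
      unfolding ab(2) using ab(1) e m_assoc by metis
    moreover have "e \<otimes> y = (e \<otimes> f) \<otimes> b"
      unfolding ab(4) using ab(3) e(1) f(1) by (simp add: m_assoc)
    ultimately show False
      using \<open>x = y\<close> f(2) ab(3) carr(3) by simp
  qed
  moreover have "x \<in> nonzero_zero_divisors R" "y \<in> nonzero_zero_divisors R"
    using carr prod unfolding nonzero_zero_divisors_def by blast+
  ultimately show "{x, y} \<in> edges (zero_divisor_graph R)"
    using prod(1) unfolding zero_divisor_graph_def by auto
qed

end

lemma exists_distinct_list:
  assumes "k \<le> card A"
  shows "\<exists>ys. distinct ys \<and> length ys = k \<and> set ys \<subseteq> A"
proof -
  obtain B where B: "B \<subseteq> A" "card B = k" "finite B"
    using obtain_subset_with_card_n[OF assms] by blast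
  then obtain ys where "set ys = B" "distinct ys"
    using finite_distinct_list by blast
  then show ?thesis
    using B distinct_card by metis
qed

text \<open>
  Otherwise the complete bipartite graph between the corners contains a star with four edges centred
  at \<open>e\<close>, or two vertices of one corner joined to three of the other one.
\<close>

lemma (in cring) outerplanar_corner_card_le:
  assumes outerplanar: "outerplanar (line_graph (zero_divisor_graph R))"
    and fin: "finite (carrier R)" and e: "e \<in> carrier R" "e \<otimes> e = e" "e \<noteq> \<zero>"
  shows "card (carrier (corner_ring R (\<one> \<ominus> e))) \<le> 4"
    "card (carrier (corner_ring R e)) \<le> 2 \<or> card (carrier (corner_ring R (\<one> \<ominus> e))) \<le> 3"
proof -
  define A B where "A = carrier (corner_ring R e) - {\<zero>}"
    and "B = carrier (corner_ring R (\<one> \<ominus> e)) - {\<zero>}"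
  have edge: "{x, y} \<in> edges (zero_divisor_graph R)" "x \<noteq> y" if "x \<in> A" "y \<in> B" for x y
    using corner_edge[OF e(1,2) that[unfolded A_def B_def]] by blast+
  have zero: "\<zero> \<in> carrier (corner_ring R u)" if "u \<in> carrier R" for u
    unfolding corner_ring_simps by (rule image_eqI[of _ _ \<zero>]) (use that in simp_all)
  have fin_corner: "finite (carrier (corner_ring R u))" for u
    using fin by simp
  have card_A: "card (carrier (corner_ring R e)) = Suc (card A)"
    unfolding A_def by (rule card_Suc_Diff1[symmetric, OF fin_corner zero[OF e(1)]])
  have card_B: "card (carrier (corner_ring R (\<one> \<ominus> e))) = Suc (card B)"
    unfolding B_def by (rule card_Suc_Diff1[symmetric, OF fin_corner zero]) (use e(1) in simp)
  have "e \<otimes> e \<in> carrier (corner_ring R e)"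
    unfolding corner_ring_simps by (rule imageI[OF e(1)])
  then have "e \<in> A"
    unfolding e(2) A_def using e(3) by blast
  have "\<not> 4 \<le> card B"
  proof
    assume "4 \<le> card B"
    then obtain ys where ys: "distinct ys" "length ys = 4" "set ys \<subseteq> B"
      using exists_distinct_list by blast
    then obtain y1 y2 y3 y4 where y: "ys = [y1, y2, y3, y4]"
      by (auto simp: numeral_eq_Suc length_Suc_conv)
    have mem: "y1 \<in> B" "y2 \<in> B" "y3 \<in> B" "y4 \<in> B"
      using ys(3) by (simp_all add: y)
    have "\<not> outerplanar (line_graph (zero_divisor_graph R))"
      by (rule star4_line_graph_not_outerplanar[of e y1 y2 y3 y4])
        (use ys(1) mem edge[OF \<open>e \<in> A\<close>] in \<open>simp_all add: y\<close>)
    then show False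
      using outerplanar by blast
  qed
  then show "card (carrier (corner_ring R (\<one> \<ominus> e))) \<le> 4"
    unfolding card_B by simp
  have "\<not> (2 \<le> card A \<and> 3 \<le> card B)"
  proof
    assume "2 \<le> card A \<and> 3 \<le> card B"
    then obtain xs ys where xs: "distinct xs" "length xs = 2" "set xs \<subseteq> A"
      and ys: "distinct ys" "length ys = 3" "set ys \<subseteq> B"
      using exists_distinct_list[of 2 A] exists_distinct_list[of 3 B] by auto
    then obtain x1 x2 y1 y2 y3 where xy: "xs = [x1, x2]" "ys = [y1, y2, y3]"
      by (auto simp: numeral_eq_Suc length_Suc_conv)
    have mem: "x1 \<in> A" "x2 \<in> A" "y1 \<in> B" "y2 \<in> B" "y3 \<in> B"
      using xs(3) ys(3) by (simp_all add: xy)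
    have "\<not> outerplanar (line_graph (zero_divisor_graph R))"
      by (rule K23_line_graph_not_outerplanar[of x1 x2 y1 y2 y3])
        (use xs(1) ys(1) edge mem in \<open>simp_all add: xy\<close>)
    then show False
      using outerplanar by blast
  qed
  then show "card (carrier (corner_ring R e)) \<le> 2 \<or> card (carrier (corner_ring R (\<one> \<ominus> e))) \<le> 3"
    unfolding card_A card_B by auto
qed

text \<open>
  The fields of order four in the classification have integers as elements, whereas the field found in
  a corner has elements of the type of the given ring; renaming the elements bridges the gap.
\<close>

lemma finite_field_int_copy:
  assumes "field R" "finite (carrier R)"
  shows "\<exists>F :: int ring. field F \<and> card (carrier F) = card (carrier R) \<and> R \<simeq> F"
proof -
  obtain g :: "'a \<Rightarrow> nat" where "inj_on g (carrier R)"
    using finite_imp_inj_to_nat_seg[OF assms(2)] by blast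
  then have inj: "inj_on (\<lambda>x. int (g x)) (carrier R)"
    by (simp add: inj_on_def)
  let ?F = "image_ring (\<lambda>x. int (g x)) R"
  have "R \<simeq> ?F"
    using inj_imp_image_ring_iso[OF inj] unfolding is_ring_iso_def by blast
  moreover from this have "card (carrier ?F) = card (carrier R)"
    by (rule ring_iso_same_card[symmetric])
  ultimately show ?thesis
    using field.inj_imp_image_ring_is_field[OF assms(1) inj] by (intro exI[of _ ?F] conjI)
qed

section \<open>Zero-divisor graphs of the listed rings\<close>

lemma zero_divisor_graph_edgeE:
  assumes "d \<in> edges (zero_divisor_graph R)"
  obtains u v where "d = {u, v}" "u \<in> nonzero_zero_divisors R" "v \<in> nonzero_zero_divisors R"
    "u \<noteq> v" "u \<otimes>\<^bsub>R\<^esub> v = \<zero>\<^bsub>R\<^esub>"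
  using assms unfolding zero_divisor_graph_def by auto

lemma zero_divisor_graph_embeddingI:
  assumes inj: "inj_on f (nonzero_zero_divisors R)"
    and vertex: "\<And>u. u \<in> nonzero_zero_divisors R \<Longrightarrow> f u \<in> vertices H"
    and edge: "\<And>u v. u \<in> nonzero_zero_divisors R \<Longrightarrow> v \<in> nonzero_zero_divisors R \<Longrightarrow> u \<noteq> v \<Longrightarrow>
        u \<otimes>\<^bsub>R\<^esub> v = \<zero>\<^bsub>R\<^esub> \<Longrightarrow> {f u, f v} \<in> edges H"
  shows "graph_embedding f (zero_divisor_graph R) H"
  unfolding graph_embedding_def
proof (intro conjI ballI)
  have V: "vertices (zero_divisor_graph R) = nonzero_zero_divisors R"
    by (simp add: zero_divisor_graph_def)
  show "edges (zero_divisor_graph R) \<subseteq> Pow (vertices (zero_divisor_graph R))"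
    unfolding V by (auto elim!: zero_divisor_graph_edgeE)
  show "inj_on f (vertices (zero_divisor_graph R))"
    unfolding V by (rule inj)
  show "f ` vertices (zero_divisor_graph R) \<subseteq> vertices H"
    unfolding V using vertex by blast
  fix d assume "d \<in> edges (zero_divisor_graph R)"
  then show "f ` d \<in> edges H"
    by (elim zero_divisor_graph_edgeE) (simp add: edge)
qed

lemma ring_iso_zero_divisor_graph_embedding:
  assumes "ring R" "ring S" and h: "h \<in> ring_iso R S"
  shows "graph_embedding h (zero_divisor_graph R) (zero_divisor_graph S)"
proof (rule zero_divisor_graph_embeddingI)
  have hom: "h \<in> ring_hom R S" and bij: "bij_betw h (carrier R) (carrier S)"
    using h unfolding ring_iso_def by auto
  have zero: "h \<zero>\<^bsub>R\<^esub> = \<zero>\<^bsub>S\<^esub>"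
    by (rule ring_hom_zero[OF hom assms(1,2)])
  have inj: "inj_on h (carrier R)"
    using bij by (rule bij_betw_imp_inj_on)
  have R0: "\<zero>\<^bsub>R\<^esub> \<in> carrier R"
    using assms(1) by (simp add: ring.ring_simprules)
  have nonzero: "h u \<in> carrier S - {\<zero>\<^bsub>S\<^esub>}" if "u \<in> carrier R - {\<zero>\<^bsub>R\<^esub>}" for u
    using that ring_hom_closed[OF hom] inj_onD[OF inj _ _ R0, of u] zero by auto
  have prod: "h u \<otimes>\<^bsub>S\<^esub> h v = \<zero>\<^bsub>S\<^esub>"
    if "u \<in> carrier R" "v \<in> carrier R" "u \<otimes>\<^bsub>R\<^esub> v = \<zero>\<^bsub>R\<^esub>" for u v
    using ring_hom_mult[OF hom that(1,2)] that(3) zero by simp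
  show "inj_on h (nonzero_zero_divisors R)"
    using inj by (rule inj_on_subset) (auto simp: nonzero_zero_divisors_def)
  have vertex: "h u \<in> nonzero_zero_divisors S" if u: "u \<in> nonzero_zero_divisors R" for u
  proof -
    obtain v where v: "u \<in> carrier R - {\<zero>\<^bsub>R\<^esub>}" "v \<in> carrier R - {\<zero>\<^bsub>R\<^esub>}" "u \<otimes>\<^bsub>R\<^esub> v = \<zero>\<^bsub>R\<^esub>"
      using u unfolding nonzero_zero_divisors_def by blast
    have "h u \<otimes>\<^bsub>S\<^esub> h v = \<zero>\<^bsub>S\<^esub>"
      using v by (intro prod) auto
    then show ?thesis
      using nonzero[OF v(1)] nonzero[OF v(2)] unfolding nonzero_zero_divisors_def by blast
  qed
  then show "h u \<in> vertices (zero_divisor_graph S)" if "u \<in> nonzero_zero_divisors R" for u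
    using that by (simp add: zero_divisor_graph_def)
  show "{h u, h v} \<in> edges (zero_divisor_graph S)"
    if uv: "u \<in> nonzero_zero_divisors R" "v \<in> nonzero_zero_divisors R" "u \<noteq> v" "u \<otimes>\<^bsub>R\<^esub> v = \<zero>\<^bsub>R\<^esub>"
    for u v
  proof -
    have carr: "u \<in> carrier R" "v \<in> carrier R"
      using uv by (simp_all add: nonzero_zero_divisors_def)
    then have "h u \<noteq> h v"
      using uv(3) inj_onD[OF inj, of u v] by blast
    then show ?thesis
      using vertex[OF uv(1)] vertex[OF uv(2)] prod[OF carr uv(4)]
      unfolding zero_divisor_graph_def sgraph.simps by blast
  qed
qed

lemma outerplanar_if_iso_embeds:
  assumes "ring R" "ring S" "R \<simeq> S" "\<exists>f. graph_embedding f (zero_divisor_graph S) H"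
    and "outerplanar (line_graph H)"
  shows "outerplanar (line_graph (zero_divisor_graph R))"
proof -
  obtain h f where h: "h \<in> ring_iso R S" and f: "graph_embedding f (zero_divisor_graph S) H"
    using assms(3,4) unfolding is_ring_iso_def by blast
  have "graph_embedding (f \<circ> h) (zero_divisor_graph R) H"
    by (rule graph_embedding_comp[OF ring_iso_zero_divisor_graph_embedding[OF assms(1,2) h] f])
  then show ?thesis
    using outerplanar_graph_embedding[OF assms(5)] graph_embedding_line_graph by blast
qed

lemma residue_ring_2_simps [simp]:
  "carrier (residue_ring 2) = {0, 1}" "\<zero>\<^bsub>residue_ring 2\<^esub> = 0" "\<one>\<^bsub>residue_ring 2\<^esub> = 1"
  "x \<otimes>\<^bsub>residue_ring 2\<^esub> y = x * y mod 2"
  by (auto simp: residue_ring_def)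

lemma residue_ring_cring: "n > 1 \<Longrightarrow> cring (residue_ring n)"
  by (rule residues.cring) (simp add: residues_def)

lemma residue_ring_is_ring: "n > 1 \<Longrightarrow> ring (residue_ring n)"
  by (rule cring.axioms(1)[OF residue_ring_cring])

text \<open>
  The hypothesis on products covers two kinds of rings \<open>S\<close> of order at most four: those without zero
  divisors, for any choice of \<open>s\<close>, and those with a single nonzero zero divisor \<open>s\<close>, whose square
  vanishes. The element \<open>(1, 0)\<close> is adjacent to all \<open>(0, b)\<close>, of which there are at most three; it
  becomes the corner \<open>0\<close> of the net, whose neighbours are \<open>1\<close>, \<open>2\<close> and \<open>3\<close>. The only other possible edge
  joins \<open>(0, s)\<close> to \<open>(1, s)\<close>, and these become the corner \<open>1\<close> and its pendant vertex \<open>4\<close>.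
\<close>

lemma Z2_product_embeds_net:
  fixes S :: "('b, 'c) ring_scheme"
  assumes ring: "ring S" and fin: "finite (carrier S)" and card: "card (carrier S) \<le> 4"
    and s: "s \<in> carrier S" "s \<noteq> \<zero>\<^bsub>S\<^esub>"
    and products: "\<And>u v. u \<in> carrier S - {\<zero>\<^bsub>S\<^esub>} \<Longrightarrow> v \<in> carrier S - {\<zero>\<^bsub>S\<^esub>} \<Longrightarrow>
        u \<otimes>\<^bsub>S\<^esub> v = \<zero>\<^bsub>S\<^esub> \<Longrightarrow> u = s \<and> v = s"
  shows "\<exists>f. graph_embedding f (zero_divisor_graph (RDirProd (residue_ring 2) S)) net_graph"
proof -
  interpret S: ring S by (rule ring)
  let ?R = "RDirProd (residue_ring 2) S"
  define B where "B = carrier S - {\<zero>\<^bsub>S\<^esub>, s}"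
  have "card {\<zero>\<^bsub>S\<^esub>, s} = 2"
    using s(2) by (simp add: eq_commute)
  then have "card B \<le> card {2, 3 :: nat}"
    unfolding B_def using card card_Diff_subset[of "{\<zero>\<^bsub>S\<^esub>, s}" "carrier S"] s(1) by simp
  then obtain h where h: "h ` B \<subseteq> {2, 3 :: nat}" "inj_on h B"
    using card_le_inj[of B "{2, 3 :: nat}"] fin by (auto simp: B_def)
  define f where "f p = (if fst p = (0::int) then (if snd p = s then 1 else h (snd p))
    else if snd p = \<zero>\<^bsub>S\<^esub> then 0 else (4::nat))" for p
  have B: "b \<in> carrier S - {\<zero>\<^bsub>S\<^esub>}" "b \<noteq> s" if "b \<in> B" for b
    using that by (simp_all add: B_def)
  have sS: "s \<in> carrier S - {\<zero>\<^bsub>S\<^esub>}"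
    using s by simp
  have f: "f (0, s) = 1" "f (1, \<zero>\<^bsub>S\<^esub>) = 0" "f (1, s) = 4"
    using s(2) by (simp_all add: f_def)
  have fB: "f (0, b) = h b" if "b \<in> B" for b
    using B(2)[OF that] by (simp add: f_def)
  have h23: "h b = 2 \<or> h b = 3" if "b \<in> B" for b
    using h(1) that by auto
  have products_B: "b \<otimes>\<^bsub>S\<^esub> d \<noteq> \<zero>\<^bsub>S\<^esub>" "b \<otimes>\<^bsub>S\<^esub> s \<noteq> \<zero>\<^bsub>S\<^esub>" "s \<otimes>\<^bsub>S\<^esub> b \<noteq> \<zero>\<^bsub>S\<^esub>"
    if "b \<in> B" "d \<in> B" for b d
    using products[OF B(1)[OF that(1)] B(1)[OF that(2)]] products[OF B(1)[OF that(1)] sS]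
      products[OF sS B(1)[OF that(1)]] B(2)[OF that(1)] by blast+
  have vertexD: "w = (0, s) \<or> (\<exists>b\<in>B. w = (0, b)) \<or> w = (1, \<zero>\<^bsub>S\<^esub>) \<or> w = (1, s)"
    if w: "w \<in> nonzero_zero_divisors ?R" for w
  proof -
    obtain w' where w': "w \<in> carrier ?R - {\<zero>\<^bsub>?R\<^esub>}" "w' \<in> carrier ?R - {\<zero>\<^bsub>?R\<^esub>}"
        "w \<otimes>\<^bsub>?R\<^esub> w' = \<zero>\<^bsub>?R\<^esub>"
      using w unfolding nonzero_zero_divisors_def by blast
    obtain a b c d where ab: "w = (a, b)" "w' = (c, d)"
      by fastforce
    have *: "a = 0 \<or> a = 1" "b \<in> carrier S" "a = 0 \<longrightarrow> b \<noteq> \<zero>\<^bsub>S\<^esub>"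
      "c = 0 \<or> c = 1" "d \<in> carrier S" "c = 0 \<longrightarrow> d \<noteq> \<zero>\<^bsub>S\<^esub>" "a * c mod 2 = 0" "b \<otimes>\<^bsub>S\<^esub> d = \<zero>\<^bsub>S\<^esub>"
      using w' unfolding ab by simp_all
    show ?thesis
    proof (cases "a = 0")
      case True
      then show ?thesis
        using * unfolding ab by (auto simp: B_def)
    next
      case False
      then have "a = 1" "c = 0"
        using *(1,4,7) by auto
      then show ?thesis
        using products[of b d] *(2,5,6,8) unfolding ab by auto
    qed
  qed
  have "graph_embedding f (zero_divisor_graph ?R) net_graph"
  proof (rule zero_divisor_graph_embeddingI)
    show "inj_on f (nonzero_zero_divisors ?R)"
    proof (rule inj_onI)
      fix u v assume u: "u \<in> nonzero_zero_divisors ?R" and v: "v \<in> nonzero_zero_divisors ?R"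
        and eq: "f u = f v"
      show "u = v"
        using vertexD[OF u] vertexD[OF v] eq
        by (elim disjE bexE) (auto simp: f fB dest: h23 inj_onD[OF h(2)])
    qed
    show "f u \<in> vertices net_graph" if u: "u \<in> nonzero_zero_divisors ?R" for u
      using vertexD[OF u]
      by (elim disjE bexE) (auto simp: f fB net_graph_def dest: h23)
    show "{f u, f v} \<in> edges net_graph"
      if u: "u \<in> nonzero_zero_divisors ?R" and v: "v \<in> nonzero_zero_divisors ?R" and "u \<noteq> v"
        and prod: "u \<otimes>\<^bsub>?R\<^esub> v = \<zero>\<^bsub>?R\<^esub>" for u v
      using vertexD[OF u] vertexD[OF v] \<open>u \<noteq> v\<close> prod
      by (elim disjE bexE)
        (auto simp: f fB products_B net_graph_def doubleton_eq_iff dest: h23)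
  qed
  then show ?thesis by blast
qed

lemma domain_nonzero_products:
  assumes "domain S" "u \<in> carrier S - {\<zero>\<^bsub>S\<^esub>}" "v \<in> carrier S - {\<zero>\<^bsub>S\<^esub>}" "u \<otimes>\<^bsub>S\<^esub> v = \<zero>\<^bsub>S\<^esub>"
  shows False
  using domain.integral[OF assms(1,4)] assms(2,3) by auto

lemma Z2_domain_embeds_net:
  fixes S :: "('b, 'c) ring_scheme"
  assumes "domain S" "finite (carrier S)" "card (carrier S) \<le> 4"
  shows "\<exists>f. graph_embedding f (zero_divisor_graph (RDirProd (residue_ring 2) S)) net_graph"
proof -
  interpret S: domain S by (rule assms(1))
  show ?thesis
    by (rule Z2_product_embeds_net[OF S.ring_axioms assms(2,3) S.one_closed S.one_not_zero])
      (use domain_nonzero_products[OF assms(1)] in blast)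
qed

lemma Z2_Z4_embeds_net:
  "\<exists>f. graph_embedding f (zero_divisor_graph (RDirProd (residue_ring 2) (residue_ring 4))) net_graph"
proof (rule Z2_product_embeds_net[where s = 2])
  have carr: "carrier (residue_ring 4) = {0, 1, 2, 3}"
    by (auto simp: residue_ring_def)
  then show "finite (carrier (residue_ring 4))" "card (carrier (residue_ring 4)) \<le> 4"
    "2 \<in> carrier (residue_ring 4)"
    by simp_all
  show "2 \<noteq> \<zero>\<^bsub>residue_ring 4\<^esub>"
    by (simp add: residue_ring_def)
  show "u = 2 \<and> v = 2" if "u \<in> carrier (residue_ring 4) - {\<zero>\<^bsub>residue_ring 4\<^esub>}"
    "v \<in> carrier (residue_ring 4) - {\<zero>\<^bsub>residue_ring 4\<^esub>}"
    "u \<otimes>\<^bsub>residue_ring 4\<^esub> v = \<zero>\<^bsub>residue_ring 4\<^esub>" for u v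
    using that unfolding carr by (auto simp: residue_ring_def)
qed (rule residue_ring_is_ring, simp)

lemma Z2_dual_numbers_embeds_net:
  "\<exists>f. graph_embedding f (zero_divisor_graph (RDirProd (residue_ring 2) Z2_dual_numbers)) net_graph"
proof -
  define D where "D = Z2_dual_numbers"
  note dual = Z2_dual_numbers_structure[folded D_def]
  interpret D: cring D by (rule dual(1))
  obtain s where s: "s \<in> carrier D" "s \<noteq> \<zero>\<^bsub>D\<^esub>" "s \<otimes>\<^bsub>D\<^esub> s = \<zero>\<^bsub>D\<^esub>"
    using dual(4) by blast
  have dist: "distinct [\<zero>\<^bsub>D\<^esub>, \<one>\<^bsub>D\<^esub>, s, \<one>\<^bsub>D\<^esub> \<oplus>\<^bsub>D\<^esub> s]"
    by (rule D.dual_number_distinct[OF dual(3) s])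
  then have "s \<noteq> \<one>\<^bsub>D\<^esub>" by auto
  note elems = D.char_two_four_elements[OF dual(3,2) s(1,2) this]
  note tables = D.dual_number_tables[OF dual(3) s(1,3)]
  have "\<exists>f. graph_embedding f (zero_divisor_graph (RDirProd (residue_ring 2) D)) net_graph"
  proof (rule Z2_product_embeds_net[OF D.ring_axioms _ _ s(1,2)])
    show "finite (carrier D)"
      unfolding elems by simp
    show "card (carrier D) \<le> 4"
      by (simp add: dual(2))
    fix u v assume u: "u \<in> carrier D - {\<zero>\<^bsub>D\<^esub>}" and v: "v \<in> carrier D - {\<zero>\<^bsub>D\<^esub>}"
      and prod: "u \<otimes>\<^bsub>D\<^esub> v = \<zero>\<^bsub>D\<^esub>"
    have "u = \<one>\<^bsub>D\<^esub> \<or> u = s \<or> u = \<one>\<^bsub>D\<^esub> \<oplus>\<^bsub>D\<^esub> s" "v = \<one>\<^bsub>D\<^esub> \<or> v = s \<or> v = \<one>\<^bsub>D\<^esub> \<oplus>\<^bsub>D\<^esub> s"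
      using u v unfolding elems by blast+
    then show "u = s \<and> v = s"
      using prod dist s(1) by (elim disjE) (simp_all add: tables)
  qed
  then show ?thesis
    unfolding D_def .
qed

lemma Z3_Z3_embeds_four_cycle:
  "\<exists>f. graph_embedding f (zero_divisor_graph (RDirProd (residue_ring 3) (residue_ring 3))) four_cycle"
proof -
  let ?Z3 = "residue_ring 3"
  have Z3 [simp]: "carrier ?Z3 = {0, 1, 2}" "\<zero>\<^bsub>?Z3\<^esub> = 0" "x \<otimes>\<^bsub>?Z3\<^esub> y = x * y mod 3" for x y
    by (auto simp: residue_ring_def)
  define f :: "int \<times> int \<Rightarrow> nat" where
    "f p = (if p = (1, 0) then 0 else if p = (0, 1) then 1 else if p = (2, 0) then 2 else 3)" for p
  have vertexD: "u = (1, 0) \<or> u = (0, 1) \<or> u = (2, 0) \<or> u = (0, 2)"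
    if "u \<in> nonzero_zero_divisors (RDirProd ?Z3 ?Z3)" for u
    using that unfolding nonzero_zero_divisors_def by auto
  have "graph_embedding f (zero_divisor_graph (RDirProd ?Z3 ?Z3)) four_cycle"
  proof (rule zero_divisor_graph_embeddingI)
    show "inj_on f (nonzero_zero_divisors (RDirProd ?Z3 ?Z3))"
      by (rule inj_onI, drule vertexD, drule vertexD, elim disjE) (simp_all add: f_def)
    show "f u \<in> vertices four_cycle" for u
      by (simp add: f_def four_cycle_def)
    show "{f u, f v} \<in> edges four_cycle"
      if "u \<in> nonzero_zero_divisors (RDirProd ?Z3 ?Z3)" "v \<in> nonzero_zero_divisors (RDirProd ?Z3 ?Z3)"
        "u \<noteq> v" "u \<otimes>\<^bsub>RDirProd ?Z3 ?Z3\<^esub> v = \<zero>\<^bsub>RDirProd ?Z3 ?Z3\<^esub>" for u v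
      using vertexD[OF that(1)] vertexD[OF that(2)] that(3,4)
      by (elim disjE) (simp_all add: f_def four_cycle_def doubleton_eq_iff)
  qed
  then show ?thesis by blast
qed

text \<open>
  The idempotents with one nonzero component form the triangle; the element complementary to such an
  idempotent is adjacent to that idempotent alone.
\<close>

lemma Z2_cubed_embeds_net:
  "\<exists>f. graph_embedding f (zero_divisor_graph
     (RDirProd (residue_ring 2) (RDirProd (residue_ring 2) (residue_ring 2)))) net_graph"
proof -
  let ?R = "RDirProd (residue_ring 2) (RDirProd (residue_ring 2) (residue_ring 2))"
  define f :: "int \<times> int \<times> int \<Rightarrow> nat" where
    "f p = (if p = (1, 0, 0) then 0 else if p = (0, 1, 0) then 1 else if p = (0, 0, 1) then 2
      else if p = (0, 1, 1) then 3 else if p = (1, 0, 1) then 4 else 5)" for p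
  have vertexD: "u = (1, 0, 0) \<or> u = (0, 1, 0) \<or> u = (0, 0, 1) \<or>
      u = (0, 1, 1) \<or> u = (1, 0, 1) \<or> u = (1, 1, 0)"
    if "u \<in> nonzero_zero_divisors ?R" for u
    using that unfolding nonzero_zero_divisors_def by auto
  have "graph_embedding f (zero_divisor_graph ?R) net_graph"
  proof (rule zero_divisor_graph_embeddingI)
    show "inj_on f (nonzero_zero_divisors ?R)"
      by (rule inj_onI, drule vertexD, drule vertexD, elim disjE) (simp_all add: f_def)
    show "f u \<in> vertices net_graph" for u
      by (simp add: f_def net_graph_def)
    show "{f u, f v} \<in> edges net_graph"
      if "u \<in> nonzero_zero_divisors ?R" "v \<in> nonzero_zero_divisors ?R"
        "u \<noteq> v" "u \<otimes>\<^bsub>?R\<^esub> v = \<zero>\<^bsub>?R\<^esub>" for u v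
      using vertexD[OF that(1)] vertexD[OF that(2)] that(3,4)
      by (elim disjE) (simp_all add: f_def net_graph_def doubleton_eq_iff)
  qed
  then show ?thesis by blast
qed

section \<open>The classification\<close>

definition outerplanar_ring_list :: "('a, 'm) ring_scheme \<Rightarrow> bool" where
  "outerplanar_ring_list A \<longleftrightarrow>
           A \<simeq> RDirProd (residue_ring 2) (residue_ring 2)
         \<or> A \<simeq> RDirProd (residue_ring 2) (residue_ring 3)
         \<or> A \<simeq> RDirProd (residue_ring 3) (residue_ring 3)
         \<or> (\<exists>F :: int ring. field F \<and> card (carrier F) = 4 \<and>
                            A \<simeq> RDirProd (residue_ring 2) F)
         \<or> A \<simeq> RDirProd (residue_ring 2) (residue_ring 4)
         \<or> A \<simeq> RDirProd (residue_ring 2) Z2_dual_numbers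
         \<or> A \<simeq> RDirProd (residue_ring 2) (RDirProd (residue_ring 2) (residue_ring 2))"

lemma listed_ring_outerplanar:
  fixes A :: "('a, 'm) ring_scheme"
  assumes A: "ring A" and "outerplanar_ring_list A"
  shows "outerplanar (line_graph (zero_divisor_graph A))"
proof -
  note net = outerplanar_if_iso_embeds[OF A _ _ _ line_graph_net_outerplanar]
  have Z2: "ring (residue_ring 2)" and Z3: "ring (residue_ring 3)" and Z4: "ring (residue_ring 4)"
    by (simp_all add: residue_ring_is_ring)
  have fields: "domain (residue_ring 2)" "domain (residue_ring 3)"
    using field.axioms(1)[OF residues_prime.is_field[of 2]]
      field.axioms(1)[OF residues_prime.is_field[of 3]] by (simp_all add: residues_prime_def)
  show ?thesis
    using assms(2) unfolding outerplanar_ring_list_def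
  proof (elim disjE exE conjE)
    assume iso: "A \<simeq> RDirProd (residue_ring 2) (residue_ring 2)"
    show ?thesis
      by (rule net[OF RDirProd_ring[OF Z2 Z2] iso Z2_domain_embeds_net[OF fields(1)]]) simp_all
  next
    assume iso: "A \<simeq> RDirProd (residue_ring 2) (residue_ring 3)"
    show ?thesis
      by (rule net[OF RDirProd_ring[OF Z2 Z3] iso Z2_domain_embeds_net[OF fields(2)]])
        (simp_all add: residue_ring_def)
  next
    assume iso: "A \<simeq> RDirProd (residue_ring 3) (residue_ring 3)"
    show ?thesis
      by (rule outerplanar_if_iso_embeds[OF A RDirProd_ring[OF Z3 Z3] iso
            Z3_Z3_embeds_four_cycle line_graph_four_cycle_outerplanar])
  next
    fix F :: "int ring"
    assume F: "field F" "card (carrier F) = 4" and iso: "A \<simeq> RDirProd (residue_ring 2) F"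
    have dom: "domain F" and ring: "ring F"
      using F(1) by (simp_all add: field_def domain_def cring_def)
    have fin: "finite (carrier F)"
      by (rule ccontr) (use F(2) in simp)
    show ?thesis
      by (rule net[OF RDirProd_ring[OF Z2 ring] iso Z2_domain_embeds_net[OF dom fin]])
        (simp add: F(2))
  next
    assume iso: "A \<simeq> RDirProd (residue_ring 2) (residue_ring 4)"
    show ?thesis
      by (rule net[OF RDirProd_ring[OF Z2 Z4] iso Z2_Z4_embeds_net])
  next
    assume iso: "A \<simeq> RDirProd (residue_ring 2) Z2_dual_numbers"
    show ?thesis
      by (rule net[OF RDirProd_ring[OF Z2 cring.axioms(1)[OF Z2_dual_numbers_structure(1)]] iso
            Z2_dual_numbers_embeds_net])
  next
    assume iso: "A \<simeq> RDirProd (residue_ring 2) (RDirProd (residue_ring 2) (residue_ring 2))"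
    show ?thesis
      by (rule net[OF RDirProd_ring[OF Z2 RDirProd_ring[OF Z2 Z2]] iso Z2_cubed_embeds_net])
  qed
qed

text \<open>
  A factor of order two is \<open>\<int>\<^sub>2\<close>, and every ring of order two, three or four is a possible
  second factor.
\<close>

lemma small_product_listed:
  assumes iso: "A \<simeq> RDirProd B C" and B: "cring B" "card (carrier B) = 2"
    and C: "cring C" "2 \<le> card (carrier C)" "card (carrier C) \<le> 4"
  shows "outerplanar_ring_list A"
proof -
  interpret C: cring C by (rule C(1))
  have B': "B \<simeq> residue_ring 2"
    using cring.prime_card_ring_iso_residue_ring[OF B(1)] B(2) by simp
  note A = ring_iso_trans[OF iso ring_iso_RDirProd[OF B']]
  have fin: "finite (carrier C)"
    by (rule ccontr) (use C(2) in simp)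
  consider "card (carrier C) = 2" | "card (carrier C) = 3" | "card (carrier C) = 4"
    using C(2,3) by linarith
  then show ?thesis
  proof cases
    case 1
    then have "C \<simeq> residue_ring 2"
      using C.prime_card_ring_iso_residue_ring by simp
    then show ?thesis
      unfolding outerplanar_ring_list_def using A by blast
  next
    case 2
    then have "C \<simeq> residue_ring 3"
      using C.prime_card_ring_iso_residue_ring by simp
    then show ?thesis
      unfolding outerplanar_ring_list_def using A by blast
  next
    case 3
    show ?thesis
      using C.card4_classification[OF 3]
    proof (elim disjE)
      assume "field C"
      then obtain F :: "int ring" where "field F" "card (carrier F) = 4" "C \<simeq> F"
        using finite_field_int_copy[OF _ fin] 3 by auto
      then show ?thesis
        unfolding outerplanar_ring_list_def using A by blast
    next
      assume "C \<simeq> residue_ring 4"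
      then show ?thesis
        unfolding outerplanar_ring_list_def using A by blast
    next
      assume "C \<simeq> Z2_dual_numbers"
      from A[OF this] show ?thesis
        unfolding outerplanar_ring_list_def by blast
    next
      assume "C \<simeq> RDirProd (residue_ring 2) (residue_ring 2)"
      from A[OF this] show ?thesis
        unfolding outerplanar_ring_list_def by blast
    qed
  qed
qed

text \<open>
  The bounds on the corners hold for \<open>e\<close> and for \<open>\<one> \<ominus> e\<close>. As both corners have at least two
  elements, either one of them has order two and the other one order at most four, or both have order
  three.
\<close>

lemma outerplanar_nonlocal_ring_listed:
  fixes A :: "('a, 'm) ring_scheme"
  assumes A: "cring A" "\<one>\<^bsub>A\<^esub> \<noteq> \<zero>\<^bsub>A\<^esub>" "finite (carrier A)" "\<not> local_ring A"
    and outerplanar: "outerplanar (line_graph (zero_divisor_graph A))"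
  shows "outerplanar_ring_list A"
proof -
  interpret A: cring A by (rule A(1))
  obtain e where e: "e \<in> carrier A" "e \<otimes>\<^bsub>A\<^esub> e = e" "e \<noteq> \<zero>\<^bsub>A\<^esub>" "e \<noteq> \<one>\<^bsub>A\<^esub>"
    using A.nonlocal_exists_idempotent[OF A(3,2,4)] by blast
  define f where "f = \<one>\<^bsub>A\<^esub> \<ominus>\<^bsub>A\<^esub> e"
  have f: "f \<in> carrier A" "f \<otimes>\<^bsub>A\<^esub> f = f" "f \<noteq> \<zero>\<^bsub>A\<^esub>"
    using A.complement_idempotent(1)[OF e(1,2)] A.complement_nonzero[OF e(1,4)] e(1)
    by (simp_all add: f_def)
  have ef: "\<one>\<^bsub>A\<^esub> \<ominus>\<^bsub>A\<^esub> f = e"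
    unfolding f_def by (rule A.complement_complement[OF e(1)])
  define B C where "B = corner_ring A e" and "C = corner_ring A f"
  have BC: "cring B" "cring C" "A \<simeq> RDirProd B C" "2 \<le> card (carrier B)" "2 \<le> card (carrier C)"
    unfolding B_def C_def
    using A.corner_ring_cring[OF e(1,2)] A.corner_ring_cring[OF f(1,2)]
      A.Peirce_decomposition[OF e(1,2), folded f_def]
      A.two_le_card_corner[OF A(3) e(1-3)] A.two_le_card_corner[OF A(3) f]
    by blast+
  have bound: "card (carrier C) \<le> 4" "card (carrier B) \<le> 2 \<or> card (carrier C) \<le> 3"
    using A.outerplanar_corner_card_le[OF outerplanar A(3) e(1-3)] unfolding B_def C_def f_def
    by blast+
  have bound': "card (carrier B) \<le> 4" "card (carrier C) \<le> 2 \<or> card (carrier B) \<le> 3"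
    using A.outerplanar_corner_card_le[OF outerplanar A(3) f] unfolding B_def C_def ef by blast+
  consider "card (carrier B) = 2" | "card (carrier C) = 2"
    | "card (carrier B) = 3" "card (carrier C) = 3"
    using BC(4,5) bound bound' by linarith
  then show ?thesis
  proof cases
    case 1
    then show ?thesis
      using small_product_listed[OF BC(3,1) _ BC(2,5) bound(1)] by blast
  next
    case 2
    have "A \<simeq> RDirProd C B"
      by (rule ring_iso_trans[OF BC(3) RDirProd_swap])
    then show ?thesis
      using small_product_listed[OF _ BC(2) 2 BC(1,4) bound'(1)] by blast
  next
    case 3
    have "B \<simeq> residue_ring 3" "C \<simeq> residue_ring 3"
      using cring.prime_card_ring_iso_residue_ring[OF BC(1)]
        cring.prime_card_ring_iso_residue_ring[OF BC(2)] 3 by simp_all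
    then have "A \<simeq> RDirProd (residue_ring 3) (residue_ring 3)"
      using ring_iso_trans[OF BC(3) ring_iso_RDirProd] by blast
    then show ?thesis
      unfolding outerplanar_ring_list_def by blast
  qed
qed

theorem theorem3p8:
  fixes A :: "('a, 'm) ring_scheme"
  assumes "cring A"
    and "\<one>\<^bsub>A\<^esub> \<noteq> \<zero>\<^bsub>A\<^esub>"
    and "finite (carrier A)"
    and "\<not> local_ring A"
  shows "outerplanar (line_graph (zero_divisor_graph A)) \<longleftrightarrow>
           A \<simeq> RDirProd (residue_ring 2) (residue_ring 2)
         \<or> A \<simeq> RDirProd (residue_ring 2) (residue_ring 3)
         \<or> A \<simeq> RDirProd (residue_ring 3) (residue_ring 3)
         \<or> (\<exists>F :: int ring. field F \<and> card (carrier F) = 4 \<and>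
                            A \<simeq> RDirProd (residue_ring 2) F)
         \<or> A \<simeq> RDirProd (residue_ring 2) (residue_ring 4)
         \<or> A \<simeq> RDirProd (residue_ring 2) Z2_dual_numbers
         \<or> A \<simeq> RDirProd (residue_ring 2) (RDirProd (residue_ring 2) (residue_ring 2))"
  unfolding outerplanar_ring_list_def[symmetric]
  using outerplanar_nonlocal_ring_listed[OF assms] listed_ring_outerplanar[OF cring.axioms(1)[OF assms(1)]]
  by blast

end
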